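(* Let $G,H$ be bipartite graphs of order $n$, $e$ a cut edge of $G$, $e'$ a cut edge of $H$, and let $G(k)$, $H(k)$ be the $k$-subdivision graphs of $G$ on $e$ and of $H$ on $e'$. Let $d_k(x)=\widetilde{\phi}(H(k),x)/\widetilde{\phi}(G(k),x)$, let $D=\{x>0\mid d_0(x)>d_1(x)\}$ and let $D^C=(0,\infty)\setminus D$. Then for every $k\ge 0$, $$\mathbb{E}(H(k))-\mathbb{E}(G(k))\ge\frac{2}{\pi}\int_0^{+\infty}\ln\min\{d_0(x),d_1(x)\}\,\mathrm{d}x=\frac{2}{\pi}\int_D\ln d_1(x)\,\mathrm{d}x+\frac{2}{\pi}\int_{D^C}\ln d_0(x)\,\mathrm{d}x,$$ and moreover $$\frac{2}{\pi}\int_D\ln d_1(x)\,\mathrm{d}x+\frac{2}{\pi}\int_{D^C}\ln d_0(x)\,\mathrm{d}x=\mathbb{E}(H(1))-\mathbb{E}(G(1))-\frac{2}{\pi}\int_{D^C}\ln\frac{d_1(x)}{d_0(x)}\,\mathrm{d}x=\mathbb{E}(H(0))-\mathbb{E}(G(0))+\frac{2}{\pi}\int_D\ln\frac{d_1(x)}{d_0(x)}\,\mathrm{d}x.$$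
   Context: The energy $\mathbb{E}(G)$ is the sum of absolute values of the adjacency eigenvalues of $G$. For a graph $G$ of order $n$, $\phi(G,x)=\det(xI-A(G))=\sum_{i=0}^n a_i(G)x^{n-i}$ and $\widetilde{\phi}(G,x)=\sum_{i=0}^n |a_i(G)|x^{n-i}$. For a cut edge $e$ of $G$, the $k$-subdivision graph $G(k)$ on $e$ is obtained by replacing $e$ with a path of length $k+1$; $G(0)=G$. *)

theory Defs
  imports
    "HOL-Analysis.Analysis"
    "Graph_Theory.Graph_Theory"
    "Jordan_Normal_Form.Spectral_Radius"
begin

text \<open>
  Finite simple graphs are represented by the locale \<^locale>\<open>pair_graph\<close>: an undirected edge
  between u and v is the pair of opposite arcs (u,v) and (v,u), and an edge is named by
  either of its two arcs.
\<close>

definition bipartite :: "'a pair_pre_digraph \<Rightarrow> bool" where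
  "bipartite G \<longleftrightarrow> (\<exists>X Y. pverts G = X \<union> Y \<and> X \<inter> Y = {} \<and>
     (\<forall>(u, v) \<in> parcs G. u \<in> X \<and> v \<in> Y \<or> u \<in> Y \<and> v \<in> X))"

definition delete_edge :: "'a pair_pre_digraph \<Rightarrow> 'a \<times> 'a \<Rightarrow> 'a pair_pre_digraph" where
  "delete_edge G e = G\<lparr>parcs := parcs G - {e, prod.swap e}\<rparr>"

text \<open>
  The arcs of a graph are symmetric, so its strongly connected components are its
  connected components.
\<close>

definition num_components :: "'a pair_pre_digraph \<Rightarrow> nat" where
  "num_components G = card (pre_digraph.sccs_verts (with_proj G))"

definition cut_edge :: "'a pair_pre_digraph \<Rightarrow> 'a \<times> 'a \<Rightarrow> bool" where
  "cut_edge G e \<longleftrightarrow> e \<in> parcs G \<and> num_components G < num_components (delete_edge G e)"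

text \<open>
  The edge e is replaced by the path with vertices \<open>subdiv_path e k 0, \<dots>, subdiv_path e k (k + 1)\<close>.
  Old vertices are tagged with \<^const>\<open>Inl\<close>; the k new inner vertices are \<open>Inr 0, \<dots>, Inr (k - 1)\<close>.
  For k = 0 this is a copy of G (see \<open>subdivision_graph_0\<close> below).
\<close>

definition subdiv_path :: "'a \<times> 'a \<Rightarrow> nat \<Rightarrow> nat \<Rightarrow> 'a + nat" where
  "subdiv_path e k i =
     (if i = 0 then Inl (fst e) else if i \<le> k then Inr (i - 1) else Inl (snd e))"

definition subdivision_graph :: "'a pair_pre_digraph \<Rightarrow> 'a \<times> 'a \<Rightarrow> nat \<Rightarrow> ('a + nat) pair_pre_digraph"
  where
  "subdivision_graph G e k = \<lparr>
     pverts = Inl ` pverts G \<union> Inr ` {..<k},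
     parcs = map_prod Inl Inl ` parcs (delete_edge G e)
       \<union> {(subdiv_path e k i, subdiv_path e k (Suc i)) | i. i \<le> k}
       \<union> {(subdiv_path e k (Suc i), subdiv_path e k i) | i. i \<le> k} \<rparr>"

text \<open>
  The vertices are enumerated by \<^const>\<open>from_nat_into\<close>, which for a finite set V is a bijection
  from \<open>{..<card V}\<close> to V. The notions below do not depend on the enumeration.
\<close>

definition adjacency_matrix :: "'a pair_pre_digraph \<Rightarrow> real mat" where
  "adjacency_matrix G = (let V = pverts G; n = card V in
     mat n n (\<lambda>(i, j). if (from_nat_into V i, from_nat_into V j) \<in> parcs G then 1 else 0))"

text \<open>Eigenvalues are counted with multiplicity. A real symmetric matrix has only real ones.\<close>

definition graph_energy :: "'a pair_pre_digraph \<Rightarrow> real" where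
  "graph_energy G = (\<Sum>a \<in> spectrum (adjacency_matrix G).
     real (order a (char_poly (adjacency_matrix G))) * \<bar>a\<bar>)"

definition abs_char_poly :: "'a pair_pre_digraph \<Rightarrow> real poly" where
  "abs_char_poly G = map_poly abs (char_poly (adjacency_matrix G))"

lemma subdivision_graph_0:
  assumes "pair_graph G" "e \<in> parcs G"
  shows "pverts (subdivision_graph G e 0) = Inl ` pverts G"
    and "parcs (subdivision_graph G e 0) = map_prod Inl Inl ` parcs G"
proof -
  interpret pair_graph G by fact
  show "pverts (subdivision_graph G e 0) = Inl ` pverts G"
    by (simp add: subdivision_graph_def)
  have "prod.swap e \<in> parcs G"
    using assms(2) arcs_symmetric by (cases e) auto
  then have "parcs G = parcs (delete_edge G e) \<union> {e, prod.swap e}"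
    using assms(2) by (auto simp: delete_edge_def)
  then show "parcs (subdivision_graph G e 0) = map_prod Inl Inl ` parcs G"
    by (cases e) (auto simp: subdivision_graph_def subdiv_path_def)
qed

lemma card_pverts_subdivision_graph:
  assumes "pair_graph G"
  shows "card (pverts (subdivision_graph G e k)) = card (pverts G) + k"
proof -
  interpret pair_graph G by fact
  let ?A = "Inl ` pverts G :: ('a + nat) set" and ?B = "Inr ` {..<k} :: ('a + nat) set"
  have "card (?A \<union> ?B) = card ?A + card ?B"
    by (rule card_Un_disjoint) (use pair_finite_verts in auto)
  then show ?thesis
    by (simp add: subdivision_graph_def card_image)
qed

lemma pair_graph_subdivision_graph:
  assumes "pair_graph G" "e \<in> parcs G"
  shows "pair_graph (subdivision_graph G e k)"
proof -
  interpret pair_graph G by fact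
  obtain u v where e: "e = (u, v)" by (cases e)
  have uv: "u \<in> pverts G" "v \<in> pverts G" "u \<noteq> v"
    using assms(2) e in_arcsD1 in_arcsD2 no_loops' by auto
  let ?S = "subdivision_graph G e k"
  have "sym (parcs (delete_edge G e))"
    using arcs_symmetric by (auto simp: delete_edge_def e intro!: symI)
  then have sym: "sym (parcs ?S)"
    by (fastforce simp: subdivision_graph_def sym_def)
  have path: "subdiv_path e k i \<in> pverts ?S" if "i \<le> Suc k" for i
    using that uv by (auto simp: subdiv_path_def subdivision_graph_def e)
  have neq: "subdiv_path e k i \<noteq> subdiv_path e k (Suc i)" if "i \<le> k" for i
    using that uv by (auto simp: subdiv_path_def e)
  have "parcs (delete_edge G e) \<subseteq> parcs G" by (auto simp: delete_edge_def)
  note del = subsetD[OF this]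
  have arcs: "a \<in> parcs ?S \<Longrightarrow> fst a \<in> pverts ?S \<and> snd a \<in> pverts ?S \<and> fst a \<noteq> snd a" for a
  proof -
    assume "a \<in> parcs ?S"
    then consider (1) b where "b \<in> parcs G" "a = map_prod Inl Inl b"
      | (2) i where "i \<le> k" "a = (subdiv_path e k i, subdiv_path e k (Suc i))"
      | (3) i where "i \<le> k" "a = (subdiv_path e k (Suc i), subdiv_path e k i)"
      using del by (fastforce simp: subdivision_graph_def)
    then show ?thesis
    proof cases
      case 1
      then show ?thesis
        using in_arcsD1 in_arcsD2 no_loops' by (cases b) (auto simp: subdivision_graph_def)
    qed (use path neq in \<open>auto, metis neq\<close>)
  qed
  have finV: "finite (pverts ?S)"
    using pair_finite_verts by (simp add: subdivision_graph_def)
  have "parcs ?S \<subseteq> pverts ?S \<times> pverts ?S"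
    using arcs by force
  then have finA: "finite (parcs ?S)"
    using finV finite_subset by blast
  show ?thesis
    using arcs finV finA sym
    by unfold_locales (auto simp: symmetric_def)
qed

end

theory Submission
  imports Defs "HOL-Real_Asymp.Real_Asymp"
begin

text \<open>
  Expanding the determinant along the bridge gives
  \<open>\<phi>(G(k+2)) = x \<phi>(G(k+1)) - \<phi>(G(k))\<close>. For a bipartite graph the substitution \<open>x \<mapsto> \<i> x\<close> turns
  \<open>\<phi>\<close> into \<open>\<phi>~\<close> up to a power of \<open>\<i>\<close>; as every G(k) is again bipartite because e is a cut edge,
  \<open>\<phi>~(G(k+2)) = x \<phi>~(G(k+1)) + \<phi>~(G(k))\<close>, so \<open>d\<^sub>k\<^sub>+\<^sub>2\<close> is a mediant of \<open>d\<^sub>k\<^sub>+\<^sub>1\<close> and \<open>d\<^sub>k\<close> and hence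
  \<open>d\<^sub>k \<ge> min d\<^sub>0 d\<^sub>1\<close> on the positive axis. The same substitution shows that \<open>\<phi>~(x)\<close> is the product of
  \<open>sqrt (x\<^sup>2 + \<lambda>\<^sup>2)\<close> over the eigenvalues \<open>\<lambda>\<close>, so integrating the logarithm factor by factor yields
  Coulson's formula \<open>E(H(k)) - E(G(k)) = 2/\<pi> \<integral> ln d\<^sub>k\<close>.
\<close>

section \<open>Determinants over finite index sets\<close>

text \<open>The Leibniz formula over an arbitrary finite index set rather than
  \<open>{0..<n}\<close>: vertices index rows and columns directly, and a principal minor is
  obtained by shrinking \<open>V\<close>.\<close>

definition det_on :: "'i set \<Rightarrow> ('i \<Rightarrow> 'i \<Rightarrow> 'a :: comm_ring_1) \<Rightarrow> 'a" where
  "det_on V M = (\<Sum>p | p permutes V. of_int (sign p) * (\<Prod>i\<in>V. M i (p i)))"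

lemma det_on_cong:
  assumes "\<And>i j. i \<in> V \<Longrightarrow> j \<in> V \<Longrightarrow> M i j = N i j"
  shows "det_on V M = det_on V N"
  unfolding det_on_def using assms
  by (intro sum.cong refl arg_cong2[of _ _ _ _ "(*)"] prod.cong) (auto simp: permutes_in_image)

text \<open>Conjugation by \<open>f\<close> is a sign-preserving bijection between the permutations
  of \<open>A\<close> and those of \<open>B\<close>, so the Leibniz sums agree term by term.\<close>

lemma det_on_reindex:
  assumes f: "bij_betw f A B" and "finite A"
  shows "det_on B M = det_on A (\<lambda>i j. M (f i) (f j))"
proof -
  have inj: "inj_on f A" and B: "B = f ` A"
    using f by (auto simp: bij_betw_def)
  have bij: "bij_betw (map_permutation A f) {p. p permutes A} {p. p permutes B}"
  proof -
    have "map_permutation A f = (\<lambda>p x. if x \<in> B then f (p (inv_into A f x)) else x)"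
      by (auto simp: map_permutation_def restrict_id_def B fun_eq_iff)
    then show ?thesis
      using bij_betw_permutations[OF f] by simp
  qed
  show ?thesis
    unfolding det_on_def
  proof (subst sum.reindex_bij_betw[OF bij, symmetric], rule sum.cong[OF refl])
    fix p assume "p \<in> {p. p permutes A}"
    then have p: "p permutes A" by simp
    have "(\<Prod>i\<in>B. M i (map_permutation A f p i)) = (\<Prod>i\<in>A. M (f i) (f (p i)))"
      unfolding B by (subst prod.reindex[OF inj]) (auto intro!: prod.cong simp: map_permutation_apply[OF inj])
    then show "of_int (sign (map_permutation A f p)) * (\<Prod>i\<in>B. M i (map_permutation A f p i))
        = of_int (sign p) * (\<Prod>i\<in>A. M (f i) (f (p i)))"
      by (simp add: sign_map_permutation[OF inj p \<open>finite A\<close>])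
  qed
qed

lemma det_on_singleton: "det_on {u} M = M u u"
  by (simp add: det_on_def permutes_sing)

lemma det_on_zero_row:
  assumes "finite V" "u \<in> V" "\<And>j. j \<in> V \<Longrightarrow> M u j = 0"
  shows "det_on V M = 0"
  unfolding det_on_def
proof (rule sum.neutral, safe)
  fix p assume p: "p permutes V"
  then have "M u (p u) = 0"
    using assms by (simp add: permutes_in_image)
  then have "(\<Prod>i\<in>V. M i (p i)) = 0"
    using assms by (auto intro: prod_zero)
  then show "of_int (sign p) * (\<Prod>i\<in>V. M i (p i)) = 0"
    by simp
qed

text \<open>Every Leibniz term contains exactly one factor from row \<open>u\<close>.\<close>

lemma det_on_row_add:
  assumes "finite V" "u \<in> V"
  shows "det_on V (M(u := \<lambda>j. r j + s j)) = det_on V (M(u := r)) + det_on V (M(u := s))"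
proof -
  have *: "(\<Prod>i\<in>V. (M(u := t)) i (p i)) = t (p u) * (\<Prod>i\<in>V - {u}. M i (p i))" for p t
    using assms by (simp add: prod.remove[of V u])
  show ?thesis
    unfolding det_on_def * by (simp add: sum.distrib algebra_simps)
qed

text \<open>Composing every permutation with the transposition of \<open>u\<close> and
  \<open>v\<close> flips its sign and merely permutes the factors of its product.\<close>

lemma det_on_swap_rows:
  assumes "finite V" "u \<in> V" "v \<in> V" "u \<noteq> v"
  shows "det_on V (M(u := M v, v := M u)) = - det_on V M"
proof -
  let ?t = "Transposition.transpose u v"
  have t: "?t permutes V"
    using assms by (simp add: permutes_swap_id)
  have "det_on V (M(u := M v, v := M u))
      = (\<Sum>p | p permutes V. of_int (sign (p \<circ> ?t)) * (\<Prod>i\<in>V. (M(u := M v, v := M u)) i ((p \<circ> ?t) i)))"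
    unfolding det_on_def by (rule sum_permutations_compose_right[OF t])
  also have "\<dots> = (\<Sum>p | p permutes V. - (of_int (sign p) * (\<Prod>i\<in>V. M i (p i))))"
  proof (rule sum.cong[OF refl], safe)
    fix p assume p: "p permutes V"
    have "sign (p \<circ> ?t) = - sign p"
      using assms p t
      by (subst sign_compose) (auto simp: permutes_imp_permutation sign_swap_id permutation_swap_id)
    moreover have "(\<Prod>i\<in>V. (M(u := M v, v := M u)) i ((p \<circ> ?t) i)) = (\<Prod>i\<in>V. M (?t i) (p (?t i)))"
      by (rule prod.cong) (auto simp: Transposition.transpose_def)
    moreover have "\<dots> = (\<Prod>i\<in>V. M i (p i))"
      using prod.permute[OF t, of "\<lambda>i. M i (p i)"] by (simp add: o_def)
    ultimately show "of_int (sign (p \<circ> ?t)) * (\<Prod>i\<in>V. (M(u := M v, v := M u)) i ((p \<circ> ?t) i))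
        = - (of_int (sign p) * (\<Prod>i\<in>V. M i (p i)))"
      by simp
  qed
  finally show ?thesis
    by (simp add: det_on_def sum_negf)
qed

text \<open>A permutation sending some index of \<open>A\<close> into \<open>B\<close> contributes a
  zero factor. The surviving ones preserve \<open>A\<close>, hence also \<open>B\<close>, and
  correspond to pairs of permutations of the two blocks, with signs multiplying.\<close>

lemma det_on_block_triangular:
  assumes fin: "finite A" "finite B" and disj: "A \<inter> B = {}"
    and zero: "\<And>i j. i \<in> A \<Longrightarrow> j \<in> B \<Longrightarrow> M i j = 0"
  shows "det_on (A \<union> B) M = det_on A M * det_on B M"
proof -
  let ?g = "\<lambda>V p. of_int (sign p) * (\<Prod>i\<in>V. M i (p i))"
  let ?S = "{p. p permutes A \<union> B \<and> p ` A \<subseteq> A}"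
  have "det_on (A \<union> B) M = sum (?g (A \<union> B)) ?S"
    unfolding det_on_def
  proof (rule sum.mono_neutral_right)
    show "finite {p. p permutes A \<union> B}"
      using fin by (simp add: finite_permutations)
    show "\<forall>p\<in>{p. p permutes A \<union> B} - ?S. ?g (A \<union> B) p = 0"
    proof
      fix p assume "p \<in> {p. p permutes A \<union> B} - ?S"
      then obtain i where "p permutes A \<union> B" "i \<in> A" "p i \<notin> A" by auto
      moreover from this have "p i \<in> B"
        by (metis Un_iff permutes_in_image)
      ultimately have "(\<Prod>i\<in>A \<union> B. M i (p i)) = 0"
        using zero fin by (intro prod_zero) auto
      then show "?g (A \<union> B) p = 0" by simp
    qed
  qed auto
  also have "\<dots> = (\<Sum>(p, q)\<in>{p. p permutes A} \<times> {q. q permutes B}. ?g A p * ?g B q)"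
  proof (rule sum.reindex_bij_witness
      [of _ "\<lambda>(p, q). p \<circ> q" "\<lambda>p. (restrict_id p A, restrict_id p B)"])
    fix p assume "p \<in> ?S"
    then have p: "p permutes A \<union> B" and pA: "p ` A \<subseteq> A" by auto
    have inj: "inj_on p X" for X
      using permutes_inj[OF p] by (rule inj_on_subset) simp
    have pA': "p ` A = A"
      by (simp add: endo_inj_surj fin(1) inj pA)
    have pB: "p ` B = B"
    proof -
      have "B = (A \<union> B) - A" using disj by auto
      then have "p ` B = p ` (A \<union> B) - p ` A"
        using image_set_diff[OF permutes_inj[OF p], of "A \<union> B" A] by simp
      then show ?thesis
        using pA' permutes_image[OF p] disj by auto
    qed
    have bA: "bij_betw p A A" and bB: "bij_betw p B B"
      using pA' pB inj by (auto simp: bij_betw_def)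
    note rA = permutes_restrict_id[OF bA] and rB = permutes_restrict_id[OF bB]
    show "(restrict_id p A, restrict_id p B) \<in> {p. p permutes A} \<times> {q. q permutes B}"
      using rA rB by simp
    show eq: "(case (restrict_id p A, restrict_id p B) of (p, q) \<Rightarrow> p \<circ> q) = p"
      using p pB disj by (auto simp: fun_eq_iff restrict_id_def permutes_def)
    have "sign p = sign (restrict_id p A) * sign (restrict_id p B)"
      using eq sign_compose[OF permutes_imp_permutation[OF fin(1) rA] permutes_imp_permutation[OF fin(2) rB]]
      by simp
    moreover have "(\<Prod>i\<in>A \<union> B. M i (p i)) = (\<Prod>i\<in>A. M i (restrict_id p A i)) * (\<Prod>i\<in>B. M i (restrict_id p B i))"
      using fin disj by (subst prod.union_disjoint) auto
    ultimately show "(case (restrict_id p A, restrict_id p B) of (p, q) \<Rightarrow> ?g A p * ?g B q) = ?g (A \<union> B) p"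
      by simp
  next
    fix pq assume "pq \<in> {p. p permutes A} \<times> {q. q permutes B}"
    then obtain p q where pq: "pq = (p, q)" "p permutes A" "q permutes B" by auto
    show "(case pq of (p, q) \<Rightarrow> p \<circ> q) \<in> ?S"
    proof -
      have "p permutes A \<union> B" "q permutes A \<union> B"
        using pq by (auto intro: permutes_subset)
      moreover have "(p \<circ> q) ` A \<subseteq> A"
        using pq disj by (auto simp: permutes_in_image permutes_not_in[of q B] disjoint_iff)
      ultimately show ?thesis
        using pq by (auto intro: permutes_compose)
    qed
    have "restrict_id (p \<circ> q) A = p"
      using pq disj by (auto simp: fun_eq_iff restrict_id_def permutes_not_in disjoint_iff)
    moreover have "restrict_id (p \<circ> q) B = q"
    proof
      fix x show "restrict_id (p \<circ> q) B x = q x"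
      proof (cases "x \<in> B")
        case True
        then have "q x \<in> B" using pq by (simp add: permutes_in_image)
        then have "q x \<notin> A" using disj by auto
        then show ?thesis using True pq by (simp add: permutes_not_in)
      qed (use pq in \<open>simp add: permutes_not_in\<close>)
    qed
    ultimately show "(restrict_id (case pq of (p, q) \<Rightarrow> p \<circ> q) A,
        restrict_id (case pq of (p, q) \<Rightarrow> p \<circ> q) B) = pq"
      using pq by simp
  qed
  also have "\<dots> = det_on A M * det_on B M"
    by (simp add: det_on_def sum_product sum.cartesian_product)
  finally show ?thesis .
qed

lemma det_on_unit_row:
  assumes "finite V" "u \<in> V" "\<And>j. j \<in> V \<Longrightarrow> j \<noteq> u \<Longrightarrow> M u j = 0"
  shows "det_on V M = M u u * det_on (V - {u}) M"
proof -
  have "det_on ({u} \<union> (V - {u})) M = det_on {u} M * det_on (V - {u}) M"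
    using assms by (intro det_on_block_triangular) auto
  then show ?thesis
    using assms by (simp add: det_on_singleton insert_absorb)
qed

text \<open>Row \<open>u\<close> is split into its part on \<open>A\<close> and its entry in column
  \<open>v\<close>; row \<open>v\<close> is then split in the same way. The part of row
  \<open>u\<close> on \<open>A\<close> leaves a block triangular matrix and gives the first product;
  the entries of the bridge itself give the second.\<close>

lemma det_on_bridge:
  assumes fin: "finite A" "finite B" and disj: "A \<inter> B = {}" and u: "u \<in> A" and v: "v \<in> B"
    and AB: "\<And>i j. i \<in> A \<Longrightarrow> j \<in> B \<Longrightarrow> (i, j) \<noteq> (u, v) \<Longrightarrow> M i j = 0"
    and BA: "\<And>i j. i \<in> B \<Longrightarrow> j \<in> A \<Longrightarrow> (i, j) \<noteq> (v, u) \<Longrightarrow> M i j = 0"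
  shows "det_on (A \<union> B) M
    = det_on A M * det_on B M - M u v * M v u * det_on (A - {u}) M * det_on (B - {v}) M"
proof -
  let ?V = "A \<union> B"
  have uv: "u \<noteq> v" "u \<notin> B" "v \<notin> A" using disj u v by auto
  let ?on = "\<lambda>X i j. if j \<in> X then M i j else 0"
  define N where "N = M(u := ?on {v} u)"
  have "det_on ?V M = det_on ?V (M(u := \<lambda>j. ?on A u j + ?on {v} u j))"
    using uv u v AB by (intro det_on_cong) auto
  also have "\<dots> = det_on ?V (M(u := ?on A u)) + det_on ?V N"
    unfolding N_def using fin u by (intro det_on_row_add) auto
  also have "det_on ?V (M(u := ?on A u)) = det_on A (M(u := ?on A u)) * det_on B (M(u := ?on A u))"
    using AB disj uv by (intro det_on_block_triangular fin disj) auto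
  also have "det_on A (M(u := ?on A u)) = det_on A M"
    by (rule det_on_cong) auto
  also have "det_on B (M(u := ?on A u)) = det_on B M"
    using uv by (intro det_on_cong) auto
  also have "det_on ?V N = det_on ?V (N(v := \<lambda>j. ?on B v j + ?on {u} v j))"
    unfolding N_def using uv u v BA by (intro det_on_cong) auto
  also have "\<dots> = det_on ?V (N(v := ?on B v)) + det_on ?V (N(v := ?on {u} v))"
    using fin v by (intro det_on_row_add) auto
  \<comment> \<open>The rows of \<open>B\<close> now vanish on \<open>A\<close>, so the determinant
    factors; in the block of \<open>A\<close>, row \<open>u\<close> is zero because its only entry
    sits in column \<open>v\<close>.\<close>
  also have "det_on ?V (N(v := ?on B v)) = 0"
  proof -
    have "det_on (B \<union> A) (N(v := ?on B v)) = det_on B (N(v := ?on B v)) * det_on A (N(v := ?on B v))"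
      using BA disj uv by (intro det_on_block_triangular fin) (auto simp: N_def)
    also have "det_on A (N(v := ?on B v)) = 0"
      using fin u uv by (intro det_on_zero_row[of _ u]) (auto simp: N_def)
    finally show ?thesis by (simp only: Un_commute mult_zero_right)
  qed
  \<comment> \<open>Swapping rows \<open>u\<close> and \<open>v\<close> moves both bridge entries
    onto the diagonal, which makes the matrix block triangular and accounts for the minus
    sign.\<close>
  also have "det_on ?V (N(v := ?on {u} v)) = - det_on ?V (M(u := ?on {u} v, v := ?on {v} u))"
  proof -
    let ?L = "M(u := ?on {u} v, v := ?on {v} u)"
    have "N(v := ?on {u} v) = ?L(u := ?L v, v := ?L u)"
      using uv by (auto simp: N_def fun_eq_iff)
    then show ?thesis
      using det_on_swap_rows[of ?V u v ?L] fin u v uv(1) by simp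
  qed
  also have "det_on ?V (M(u := ?on {u} v, v := ?on {v} u))
      = det_on A (M(u := ?on {u} v, v := ?on {v} u)) * det_on B (M(u := ?on {u} v, v := ?on {v} u))"
    using AB disj uv by (intro det_on_block_triangular fin disj) auto
  also have "det_on A (M(u := ?on {u} v, v := ?on {v} u)) = M v u * det_on (A - {u}) M"
  proof -
    have "det_on (A - {u}) (M(u := ?on {u} v, v := ?on {v} u)) = det_on (A - {u}) M"
      using uv by (intro det_on_cong) auto
    then show ?thesis
      using fin u uv by (subst det_on_unit_row[of _ u]) auto
  qed
  also have "det_on B (M(u := ?on {u} v, v := ?on {v} u)) = M u v * det_on (B - {v}) M"
  proof -
    have "det_on (B - {v}) (M(u := ?on {u} v, v := ?on {v} u)) = det_on (B - {v}) M"
      using uv by (intro det_on_cong) auto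
    then show ?thesis
      using fin v uv by (subst det_on_unit_row[of _ v]) auto
  qed
  finally show ?thesis by (simp add: algebra_simps)
qed

section \<open>Subdividing a cut edge\<close>

text \<open>The characteristic polynomial of the subgraph induced on \<open>V\<close>. Since
  \<open>E\<close> may contain arcs leaving \<open>V\<close>, deleting a vertex only changes
  \<open>V\<close>.\<close>

definition char_poly_on :: "'i set \<Rightarrow> ('i \<times> 'i) set \<Rightarrow> real poly" where
  "char_poly_on V E =
     det_on V (\<lambda>i j. (if i = j then [:0, 1:] else 0) - (if (i, j) \<in> E then 1 else 0))"

lemma char_poly_on_cong:
  assumes "\<And>i j. i \<in> V \<Longrightarrow> j \<in> V \<Longrightarrow> (i, j) \<in> E \<longleftrightarrow> (i, j) \<in> F"
  shows "char_poly_on V E = char_poly_on V F"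
  unfolding char_poly_on_def using assms by (intro det_on_cong) auto

lemma char_poly_on_empty: "char_poly_on {} E = 1"
  by (simp add: char_poly_on_def det_on_def)

text \<open>The bridge formula \<phi>(G) = \<phi>(A) \<phi>(B) - \<phi>(A - u) \<phi>(B - v), read
  off from \<open>det_on_bridge\<close> with both bridge entries equal to -1.\<close>

lemma char_poly_on_bridge:
  assumes fin: "finite A" "finite B" and disj: "A \<inter> B = {}" and "u \<in> A" "v \<in> B"
    and AB: "\<And>i j. i \<in> A \<Longrightarrow> j \<in> B \<Longrightarrow> (i, j) \<in> E \<longleftrightarrow> i = u \<and> j = v"
    and BA: "\<And>i j. i \<in> A \<Longrightarrow> j \<in> B \<Longrightarrow> (j, i) \<in> E \<longleftrightarrow> i = u \<and> j = v"
  shows "char_poly_on (A \<union> B) E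
    = char_poly_on A E * char_poly_on B E - char_poly_on (A - {u}) E * char_poly_on (B - {v}) E"
proof -
  have ne: "i \<noteq> j" if "i \<in> A" "j \<in> B" for i j
    using that disj by auto
  show ?thesis
    unfolding char_poly_on_def
    using ne[OF \<open>u \<in> A\<close> \<open>v \<in> B\<close>] \<open>u \<in> A\<close> \<open>v \<in> B\<close>
    by (subst det_on_bridge[OF fin disj \<open>u \<in> A\<close> \<open>v \<in> B\<close>]) (auto simp: AB BA dest: ne)
qed

lemma char_poly_adjacency_matrix:
  assumes "finite (pverts G)"
  shows "char_poly (adjacency_matrix G) = char_poly_on (pverts G) (parcs G)"
proof -
  define V n f where "V = pverts G" and "n = card V" and "f = from_nat_into V"
  let ?A = "adjacency_matrix G"
  have A: "?A = mat n n (\<lambda>(i, j). if (f i, f j) \<in> parcs G then 1 else 0)"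
    by (simp add: adjacency_matrix_def Let_def V_def n_def f_def)
  have bij: "bij_betw f {..<n} V"
    unfolding f_def n_def using assms by (intro bij_betw_from_nat_into_finite) (simp add: V_def)
  have inj: "f i = f j \<longleftrightarrow> i = j" if "i < n" "j < n" for i j
    using bij that by (auto simp: bij_betw_def inj_on_def)
  have "char_poly ?A = det_on {..<n} (\<lambda>i j. char_poly_matrix ?A $$ (i, j))"
    unfolding char_poly_def Determinant.det_def det_on_def
    by (simp add: char_poly_matrix_def A atLeast0LessThan)
  also have "\<dots> = det_on {..<n} (\<lambda>i j. (if f i = f j then [:0, 1:] else 0)
      - (if (f i, f j) \<in> parcs G then 1 else 0))"
    by (intro det_on_cong) (auto simp: char_poly_matrix_def A inj one_pCons)
  also have "\<dots> = char_poly_on V (parcs G)"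
    unfolding char_poly_on_def by (rule det_on_reindex[OF bij, symmetric]) simp
  finally show ?thesis by (simp add: V_def)
qed

text \<open>Conjugation by the diagonal matrix with sign 1 on \<open>X\<close> and -1 elsewhere
  negates the adjacency matrix and fixes the diagonal. Along a permutation each index occurs once as
  a row and once as a column, so these signs cancel and only one factor -1 per row remains.\<close>

lemma char_poly_on_bipartite_reflect:
  assumes fin: "finite V"
    and X: "\<And>i j. i \<in> V \<Longrightarrow> j \<in> V \<Longrightarrow> (i, j) \<in> E \<Longrightarrow> i \<in> X \<longleftrightarrow> j \<notin> X"
  shows "char_poly_on V E \<circ>\<^sub>p [:0, -1:] = Polynomial.smult ((-1) ^ card V) (char_poly_on V E)"
proof -
  define s :: "'a \<Rightarrow> real poly" where "s i = (if i \<in> X then 1 else - 1)" for i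
  let ?M = "\<lambda>i j. (if i = j then [:0, 1:] else 0) - (if (i, j) \<in> E then 1 else 0 :: real poly)"
  have entry: "?M i j \<circ>\<^sub>p [:0, -1:] = - 1 * (s i * s j * ?M i j)" if "i \<in> V" "j \<in> V" for i j
    using X[OF that] by (auto simp: s_def pcompose_pCons pcompose_diff)
  have prod: "(\<Prod>i\<in>V. ?M i (p i)) \<circ>\<^sub>p [:0, -1:] = (- 1) ^ card V * (\<Prod>i\<in>V. ?M i (p i))"
    if p: "p permutes V" for p
  proof -
    have "(\<Prod>i\<in>V. ?M i (p i)) \<circ>\<^sub>p [:0, -1:] = (\<Prod>i\<in>V. - 1 * (s i * s (p i) * ?M i (p i)))"
      unfolding pcompose_prod using p by (intro prod.cong refl entry) (auto simp: permutes_in_image)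
    also have "\<dots> = (- 1) ^ card V * ((\<Prod>i\<in>V. s i) * (\<Prod>i\<in>V. s (p i)) * (\<Prod>i\<in>V. ?M i (p i)))"
      by (simp only: prod.distrib prod_constant)
    also have "(\<Prod>i\<in>V. s (p i)) = (\<Prod>i\<in>V. s i)"
      using prod.permute[OF p, of s] by (simp add: o_def)
    also have "(\<Prod>i\<in>V. s i) * (\<Prod>i\<in>V. s i) = 1"
      unfolding prod.distrib[symmetric] by (rule prod.neutral) (simp add: s_def)
    finally show ?thesis by simp
  qed
  have "char_poly_on V E \<circ>\<^sub>p [:0, -1:] = (- 1) ^ card V * char_poly_on V E"
    unfolding char_poly_on_def det_on_def pcompose_sum sum_distrib_left
  proof (rule sum.cong[OF refl])
    fix p assume "p \<in> {p. p permutes V}"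
    then have p: "p permutes V" by simp
    have "(of_int (sign p) * Q) \<circ>\<^sub>p [:0, -1:] = of_int (sign p) * (Q \<circ>\<^sub>p [:0, -1:])" for Q :: "real poly"
      by (simp add: of_int_poly pcompose_smult)
    then show "(of_int (sign p) * (\<Prod>i\<in>V. ?M i (p i))) \<circ>\<^sub>p [:0, -1:]
        = (- 1) ^ card V * (of_int (sign p) * (\<Prod>i\<in>V. ?M i (p i)))"
      by (simp only: prod[OF p] mult.left_commute)
  qed
  also have "\<dots> = Polynomial.smult ((-1) ^ card V) (char_poly_on V E)"
    by (cases "even (card V)") simp_all
  finally show ?thesis .
qed

text \<open>The set \<open>S\<close> is the component of \<open>u\<close> after deletion of the
  edge. The vertex \<open>v\<close> lies outside it, since otherwise the number of components would
  not have grown.\<close>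

lemma cut_edge_partition:
  assumes "pair_graph G" and cut: "cut_edge G (u, v)"
  obtains S where "S \<subseteq> pverts G" "u \<in> S" "v \<in> pverts G - S"
    "\<And>x y. (x, y) \<in> parcs (delete_edge G (u, v)) \<Longrightarrow> x \<in> S \<longleftrightarrow> y \<in> S"
proof -
  interpret pair_graph G by fact
  let ?E = "parcs (delete_edge G (u, v))" and ?V = "pverts G"
  define R where "R = rtrancl_on ?V ?E"
  have uv: "(u, v) \<in> parcs G" using cut by (simp add: cut_edge_def)
  then have V: "u \<in> ?V" "v \<in> ?V" by (auto dest: in_arcsD1 in_arcsD2)
  have sub: "?E \<subseteq> parcs G" by (auto simp: delete_edge_def)
  have "sym ?E"
    using arcs_symmetric by (auto simp: delete_edge_def intro!: symI)
  then have symR: "(y, x) \<in> R" if "(x, y) \<in> R" for x y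
    using that unfolding R_def by (meson rtrancl_on_sym symE)
  have stepR: "(x, z) \<in> R" if "(x, y) \<in> R" "(y, z) \<in> ?E" for x y z
    using that sub in_arcsD2 unfolding R_def by (blast intro: rtrancl_on_into_rtrancl_on)
  have "(u, v) \<notin> R"
  proof
    assume uvR: "(u, v) \<in> R"
    \<comment> \<open>Each use of the deleted edge can be bypassed by a walk between
      \<open>u\<close> and \<open>v\<close> inside \<open>R\<close>, so reachability, and with it
      the set of components, would be unchanged.\<close>
    have "rtrancl_on ?V (parcs G) = R"
    proof (intro equalityI subrelI)
      fix x y assume "(x, y) \<in> rtrancl_on ?V (parcs G)"
      then show "(x, y) \<in> R"
      proof (induction rule: rtrancl_on_induct)
        case base
        then show ?case by (simp add: R_def)
      next
        case (step y z)
        have "(y, z) \<in> R"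
        proof (cases "(y, z) \<in> ?E")
          case True
          then show ?thesis using stepR step.hyps(3) unfolding R_def by blast
        next
          case False
          then have "(y, z) = (u, v) \<or> (y, z) = (v, u)"
            using step.hyps by (auto simp: delete_edge_def)
          then show ?thesis using uvR symR by auto
        qed
        then show ?case
          using step.IH unfolding R_def by (rule rtrancl_on_trans[rotated])
      qed
    next
      fix x y assume "(x, y) \<in> R"
      then show "(x, y) \<in> rtrancl_on ?V (parcs G)"
        unfolding R_def using sub
        by (induction rule: rtrancl_on_induct) (auto intro: rtrancl_on_into_rtrancl_on)
    qed
    then have "pre_digraph.sccs_verts (with_proj G)
        = pre_digraph.sccs_verts (with_proj (delete_edge G (u, v)))"
      unfolding pre_digraph.sccs_verts_def reachable_def R_def
      by (simp add: delete_edge_def)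
    then show False
      using cut by (simp add: cut_edge_def num_components_def)
  qed
  show thesis
  proof (rule that)
    show "{x. (u, x) \<in> R} \<subseteq> ?V"
      by (auto simp: R_def dest: in_rtrancl_on_in_F)
    show "u \<in> {x. (u, x) \<in> R}" "v \<in> ?V - {x. (u, x) \<in> R}"
      using V \<open>(u, v) \<notin> R\<close> by (auto simp: R_def)
    show "x \<in> {x. (u, x) \<in> R} \<longleftrightarrow> y \<in> {x. (u, x) \<in> R}" if "(x, y) \<in> ?E" for x y
      using stepR[of u x y] stepR[of u y x] that \<open>sym ?E\<close> by (auto dest: symD)
  qed
qed

lemma subdiv_path_eq_iff:
  "subdiv_path (u, v) k i = Inl x \<longleftrightarrow> i = 0 \<and> x = u \<or> k < i \<and> x = v"
  "subdiv_path (u, v) k i = Inr m \<longleftrightarrow> i = Suc m \<and> m < k"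
  by (auto simp: subdiv_path_def)

text \<open>This replaces the path parametrisation by a case distinction on old and new vertices.
  For \<open>k = 0\<close> the path is the original edge, which therefore reappears in the first
  clause.\<close>

lemma subdivision_graph_arcs_iff:
  fixes G :: "'a pair_pre_digraph" and u v :: 'a
  defines "E \<equiv> \<lambda>k. parcs (subdivision_graph G (u, v) k)"
  shows "(Inl x, Inl y) \<in> E k \<longleftrightarrow>
      (x, y) \<in> parcs (delete_edge G (u, v)) \<or> k = 0 \<and> ((x, y) = (u, v) \<or> (x, y) = (v, u))"
    and "(Inl x, Inr i) \<in> E k \<longleftrightarrow> i < k \<and> (x = u \<and> i = 0 \<or> x = v \<and> Suc i = k)"
    and "(Inr i, Inl x) \<in> E k \<longleftrightarrow> i < k \<and> (x = u \<and> i = 0 \<or> x = v \<and> Suc i = k)"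
    and "(Inr i, Inr j) \<in> E k \<longleftrightarrow> i < k \<and> j < k \<and> (j = Suc i \<or> i = Suc j)"
proof -
  let ?p = "subdiv_path (u, v) k"
  have E: "(a, b) \<in> E k \<longleftrightarrow> (\<exists>x y. (x, y) \<in> parcs (delete_edge G (u, v)) \<and> a = Inl x \<and> b = Inl y)
      \<or> (\<exists>i\<le>k. ?p i = a \<and> ?p (Suc i) = b) \<or> (\<exists>i\<le>k. ?p (Suc i) = a \<and> ?p i = b)" for a b
    by (auto simp: E_def subdivision_graph_def)
  show "(Inl x, Inl y) \<in> E k \<longleftrightarrow>
      (x, y) \<in> parcs (delete_edge G (u, v)) \<or> k = 0 \<and> ((x, y) = (u, v) \<or> (x, y) = (v, u))"
    unfolding E subdiv_path_eq_iff by auto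
  show "(Inl x, Inr i) \<in> E k \<longleftrightarrow> i < k \<and> (x = u \<and> i = 0 \<or> x = v \<and> Suc i = k)"
    unfolding E subdiv_path_eq_iff by auto
  show "(Inr i, Inl x) \<in> E k \<longleftrightarrow> i < k \<and> (x = u \<and> i = 0 \<or> x = v \<and> Suc i = k)"
    unfolding E subdiv_path_eq_iff by auto
  show "(Inr i, Inr j) \<in> E k \<longleftrightarrow> i < k \<and> j < k \<and> (j = Suc i \<or> i = Suc j)"
    unfolding E subdiv_path_eq_iff by auto
qed

text \<open>Colours are kept on the side \<open>S\<close> of \<open>u\<close> and alternate along
  the path; on the other side they are exchanged exactly when \<open>k\<close> is odd. This is
  consistent because the path is the only link between the two sides.\<close>

lemma bipartite_subdivision_graph:
  assumes "pair_graph G" "bipartite G" "cut_edge G e"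
  shows "bipartite (subdivision_graph G e k)"
proof -
  obtain u v where e: "e = (u, v)" by (cases e)
  obtain X Y where XY: "pverts G = X \<union> Y" "X \<inter> Y = {}"
      "\<forall>(x, y) \<in> parcs G. x \<in> X \<and> y \<in> Y \<or> x \<in> Y \<and> y \<in> X"
    using assms(2) unfolding bipartite_def by blast
  have cross: "x \<in> X \<longleftrightarrow> y \<notin> X" if "(x, y) \<in> parcs G" for x y
    using XY that by auto
  have uv: "u \<in> X \<longleftrightarrow> v \<notin> X"
    using assms(3) cross by (simp add: e cut_edge_def)
  obtain S where S: "S \<subseteq> pverts G" "u \<in> S" "v \<in> pverts G - S"
    "\<And>x y. (x, y) \<in> parcs (delete_edge G (u, v)) \<Longrightarrow> x \<in> S \<longleftrightarrow> y \<in> S"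
    using cut_edge_partition[of G u v] assms unfolding e by metis
  let ?G = "subdivision_graph G e k"
  interpret sub: pair_graph ?G
    using assms by (intro pair_graph_subdivision_graph) (auto simp: cut_edge_def)
  define Z :: "('a + nat) set" where "Z = {z. case z of Inl x \<Rightarrow> if x \<in> S then x \<in> X else (x \<in> X \<longleftrightarrow> even k)
    | Inr i \<Rightarrow> (u \<in> X \<longleftrightarrow> odd i)}"
  have Z: "Inl x \<in> Z \<longleftrightarrow> (if x \<in> S then x \<in> X else (x \<in> X \<longleftrightarrow> even k))"
      "Inr i \<in> Z \<longleftrightarrow> (u \<in> X \<longleftrightarrow> odd i)" for x i
    by (simp_all add: Z_def)
  have del: "(x, y) \<in> parcs G" if "(x, y) \<in> parcs (delete_edge G (u, v))" for x y
    using that by (auto simp: delete_edge_def)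
  have "a \<in> Z \<longleftrightarrow> b \<notin> Z" if "(a, b) \<in> parcs ?G" for a b
    using that S(2,3) uv unfolding e
    by (cases a; cases b) (auto simp: subdivision_graph_arcs_iff Z dest: cross[OF del] S(4))
  then show ?thesis
    unfolding bipartite_def
    by (intro exI[of _ "pverts ?G \<inter> Z"] exI[of _ "pverts ?G - Z"])
      (auto dest: sub.in_arcsD1 sub.in_arcsD2)
qed

text \<open>The path is grown from the side of \<open>u\<close>: \<open>a k\<close> belongs to that
  side with \<open>k\<close> new vertices, \<open>a' k\<close> to the same graph without its last
  vertex \<open>t k\<close>. Applying the bridge formula to the last edge gives
  \<open>P k = a k * c - a' k * c'\<close> with \<open>c\<close> and \<open>c'\<close> independent
  of \<open>k\<close>. Since \<open>a' (Suc j) = a j\<close> and \<open>a (Suc j)\<close> equals x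
  times \<open>a j\<close> minus \<open>a' j\<close>, the recurrence passes to
  \<open>P\<close>.\<close>

lemma char_poly_subdivision_rec:
  assumes "pair_graph G" "cut_edge G e"
  defines "P \<equiv> \<lambda>k. char_poly (adjacency_matrix (subdivision_graph G e k))"
  shows "P (Suc (Suc k)) = [:0, 1:] * P (Suc k) - P k"
proof -
  interpret pair_graph G by fact
  obtain u v where e: "e = (u, v)" by (cases e)
  obtain S where S: "S \<subseteq> pverts G" "u \<in> S" "v \<in> pverts G - S"
    "\<And>x y. (x, y) \<in> parcs (delete_edge G (u, v)) \<Longrightarrow> x \<in> S \<longleftrightarrow> y \<in> S"
    using cut_edge_partition[of G u v] assms unfolding e by metis
  have fin: "finite S" "finite (pverts G - S)"
    using finite_subset[OF S(1) pair_finite_verts] pair_finite_verts by auto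
  let ?del = "parcs (delete_edge G (u, v))"
  \<comment> \<open>An infinite ray attached at u replaces the path, so that its initial segments do not depend on k.\<close>
  define R :: "(('a + nat) \<times> ('a + nat)) set" where
    "R = map_prod Inl Inl ` ?del \<union> {(Inl u, Inr 0), (Inr 0, Inl u)}
       \<union> {(Inr i, Inr j) | i j. j = Suc i \<or> i = Suc j}"
  have R: "(Inl x, Inl y) \<in> R \<longleftrightarrow> (x, y) \<in> ?del"
      "(Inl x, Inr i) \<in> R \<longleftrightarrow> x = u \<and> i = 0" "(Inr i, Inl x) \<in> R \<longleftrightarrow> x = u \<and> i = 0"
      "(Inr i, Inr j) \<in> R \<longleftrightarrow> j = Suc i \<or> i = Suc j" for x y i j
    by (auto simp: R_def)
  define V :: "nat \<Rightarrow> ('a + nat) set" where "V j = Inl ` S \<union> Inr ` {..<j}" for j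
  \<comment> \<open>The neighbour of \<open>v\<close> on the path; it is \<open>u\<close> itself as
    long as no vertex has been inserted.\<close>
  define t :: "nat \<Rightarrow> 'a + nat" where "t j = (case j of 0 \<Rightarrow> Inl u | Suc i \<Rightarrow> Inr i)" for j
  define W :: "('a + nat) set" where "W = Inl ` (pverts G - S)"
  define a where "a j = char_poly_on (V j) R" for j
  define a' where "a' j = char_poly_on (V j - {t j}) R" for j
  have finV: "finite (V j)" and finW: "finite W" and tV: "t j \<in> V j" for j
    using fin S(2) by (auto simp: V_def W_def t_def split: nat.split)
  have a'_Suc: "a' (Suc j) = a j" for j
  proof -
    have "V (Suc j) - {t (Suc j)} = V j" by (auto simp: V_def t_def)
    then show ?thesis by (simp add: a_def a'_def)
  qed
  have a_Suc: "a (Suc j) = [:0, 1:] * a j - a' j" for j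
  proof -
    have V_Suc: "V (Suc j) = V j \<union> {Inr j}" by (auto simp: V_def)
    have sing: "char_poly_on {Inr j :: 'a + nat} R = [:0, 1:]"
      by (simp add: char_poly_on_def det_on_singleton R)
    have "a (Suc j) = a j * char_poly_on {Inr j} R - a' j * char_poly_on ({Inr j} - {Inr j}) R"
      unfolding a_def a'_def V_Suc
      by (rule char_poly_on_bridge)
        (use finV tV in \<open>auto simp: V_def t_def R split: nat.split\<close>)
    then show ?thesis
      by (simp only: sing char_poly_on_empty Diff_cancel mult_1_right mult.commute)
  qed
  define c where "c = char_poly_on W (map_prod Inl Inl ` ?del)"
  define c' where "c' = char_poly_on (W - {Inl v}) (map_prod Inl Inl ` ?del)"
  have P: "P k = a k * c - a' k * c'" for k
  proof -
    let ?E = "parcs (subdivision_graph G (u, v) k)"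
    have VW: "pverts (subdivision_graph G (u, v) k) = V k \<union> W"
      using S(1) by (auto simp: subdivision_graph_def V_def W_def)
    have "P k = char_poly_on (V k \<union> W) ?E"
      unfolding P_def e using VW finV finW by (subst char_poly_adjacency_matrix) auto
    also have "\<dots> = char_poly_on (V k) ?E * char_poly_on W ?E
        - char_poly_on (V k - {t k}) ?E * char_poly_on (W - {Inl v}) ?E"
      by (rule char_poly_on_bridge)
        (use finV finW tV S in \<open>auto simp: V_def W_def t_def subdivision_graph_arcs_iff split: nat.split\<close>)
    \<comment> \<open>Inside \<open>V k\<close> the subdivision and the ray have the same arcs,
      because \<open>v\<close> does not belong to \<open>S\<close>.\<close>
    also have "char_poly_on (V k) ?E = a k"
      unfolding a_def using S(3)
      by (intro char_poly_on_cong) (auto simp: V_def subdivision_graph_arcs_iff R)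
    also have "char_poly_on (V k - {t k}) ?E = a' k"
      unfolding a'_def using S(3)
      by (intro char_poly_on_cong) (auto simp: V_def subdivision_graph_arcs_iff R)
    also have "char_poly_on W ?E = c"
      unfolding c_def using S(2)
      by (intro char_poly_on_cong) (auto simp: W_def subdivision_graph_arcs_iff)
    also have "char_poly_on (W - {Inl v}) ?E = c'"
      unfolding c'_def using S(2)
      by (intro char_poly_on_cong) (auto simp: W_def subdivision_graph_arcs_iff)
    finally show ?thesis .
  qed
  show ?thesis
    unfolding P a'_Suc by (simp only: a_Suc a'_Suc) (simp only: algebra_simps)
qed

section \<open>Real-rooted polynomials with alternating coefficients\<close>

interpretation of_real_poly_hom: map_poly_inj_idom_hom complex_of_real ..

text \<open>
  For polynomials of degree n: the coefficient of \<open>x\<^sup>n\<^sup>-\<^sup>2\<^sup>j\<close> has the sign of \<open>(-1)\<^sup>j\<close>, and all others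
  vanish. Stated through the substitution \<open>x \<mapsto> \<i> x\<close>, the property is evidently multiplicative.
\<close>

definition alternating :: "nat \<Rightarrow> real poly \<Rightarrow> bool" where
  "alternating n P \<longleftrightarrow> (\<exists>R. (\<forall>k. 0 \<le> coeff R k) \<and>
     map_poly complex_of_real P \<circ>\<^sub>p [:0, \<i>:] = Polynomial.smult (\<i> ^ n) (map_poly complex_of_real R))"

lemma alternatingI:
  assumes "\<And>k. 0 \<le> coeff R k"
    "map_poly complex_of_real P \<circ>\<^sub>p [:0, \<i>:] = Polynomial.smult (\<i> ^ n) (map_poly complex_of_real R)"
  shows "alternating n P"
  using assms unfolding alternating_def by blast

lemma alternating_mult:
  assumes "alternating m P" "alternating n Q"
  shows "alternating (m + n) (P * Q)"
proof -
  obtain R where R: "\<And>k. 0 \<le> coeff R k"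
    "map_poly complex_of_real P \<circ>\<^sub>p [:0, \<i>:] = Polynomial.smult (\<i> ^ m) (map_poly complex_of_real R)"
    using assms(1) unfolding alternating_def by blast
  obtain S where S: "\<And>k. 0 \<le> coeff S k"
    "map_poly complex_of_real Q \<circ>\<^sub>p [:0, \<i>:] = Polynomial.smult (\<i> ^ n) (map_poly complex_of_real S)"
    using assms(2) unfolding alternating_def by blast
  show ?thesis
  proof (rule alternatingI[of "R * S"])
    show "0 \<le> coeff (R * S) k" for k
      using R(1) S(1) by (simp add: coeff_mult sum_nonneg)
    show "map_poly complex_of_real (P * Q) \<circ>\<^sub>p [:0, \<i>:]
        = Polynomial.smult (\<i> ^ (m + n)) (map_poly complex_of_real (R * S))"
      by (simp add: of_real_poly_hom.hom_mult pcompose_mult R(2) S(2) power_add mult.commute)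
  qed
qed

text \<open>The witness is unique: comparing moduli of coefficients removes all powers of
  \<open>\<i>\<close> and forces each coefficient of \<open>R\<close> to be the absolute value of
  that of \<open>P\<close>.\<close>

lemma alternating_abs:
  assumes "alternating n P"
  shows "map_poly complex_of_real P \<circ>\<^sub>p [:0, \<i>:]
    = Polynomial.smult (\<i> ^ n) (map_poly complex_of_real (map_poly abs P))"
proof -
  obtain R where R: "\<And>k. 0 \<le> coeff R k"
    "map_poly complex_of_real P \<circ>\<^sub>p [:0, \<i>:] = Polynomial.smult (\<i> ^ n) (map_poly complex_of_real R)"
    using assms unfolding alternating_def by blast
  have "coeff R k = \<bar>coeff P k\<bar>" for k
  proof -
    have "norm (coeff (map_poly complex_of_real P \<circ>\<^sub>p [:0, \<i>:]) k)
        = norm (coeff (Polynomial.smult (\<i> ^ n) (map_poly complex_of_real R)) k)"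
      by (simp only: R(2))
    then show ?thesis
      using R(1)[of k] by (simp add: coeff_pcompose_linear coeff_map_poly norm_mult norm_power)
  qed
  then have "R = map_poly abs P"
    by (intro poly_eqI) (simp add: coeff_map_poly)
  then show ?thesis
    using R(2) by simp
qed

text \<open>The reflection law makes the roots symmetric about 0. A factor x, or a pair of roots
  combined into x^2 - a^2, is split off; each factor is alternating, and after cancelling it the law
  still holds for the shorter list.\<close>

lemma alternating_real_roots:
  fixes as :: "real list"
  defines "P \<equiv> \<lambda>as. \<Prod>a\<leftarrow>as. [:- a, 1::real:]"
  assumes "P as \<circ>\<^sub>p [:0, -1:] = Polynomial.smult ((-1) ^ length as) (P as)"
  shows "alternating (length as) (P as)"
  using assms(2)
proof (induction as rule: length_induct)
  case (1 as)
  show ?case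
  proof (cases "as = []")
    case True
    then show ?thesis
      by (intro alternatingI[of 1]) (auto simp: P_def coeff_1)
  next
    case False
    then obtain a where a: "a \<in> set as" by (cases as) auto
    have remove: "P xs = [:- b, 1:] * P (remove1 b xs)" if "b \<in> set xs" for b xs
      using that by (induction xs) (auto simp: P_def mult.left_commute simp del: mult_pCons_left)
    show ?thesis
    proof (cases "0 \<in> set as")
      case True
      let ?bs = "remove1 0 as"
      have len: "length as = Suc (length ?bs)"
        using True by (simp add: length_remove1) (metis Suc_pred length_pos_if_in_set)
      have Pas: "P as = [:0, 1:] * P ?bs"
        using remove[OF True] by simp
      have "[:0, 1:] * (P ?bs \<circ>\<^sub>p [:0, -1:]) = [:0, 1:] * Polynomial.smult ((-1) ^ length ?bs) (P ?bs)"
      proof -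
        have "- ([:0, 1:] * (P ?bs \<circ>\<^sub>p [:0, -1:])) = P as \<circ>\<^sub>p [:0, -1:]"
          by (simp add: Pas pcompose_mult pcompose_pCons)
        also have "\<dots> = - ([:0, 1:] * Polynomial.smult ((-1) ^ length ?bs) (P ?bs))"
          using 1(2) by (simp add: Pas len)
        finally show ?thesis by simp
      qed
      then have "P ?bs \<circ>\<^sub>p [:0, -1:] = Polynomial.smult ((-1) ^ length ?bs) (P ?bs)"
        by (subst (asm) mult_left_cancel) auto
      then have "alternating (length ?bs) (P ?bs)"
        using 1(1) len by simp
      moreover have "alternating 1 [:0, 1:]"
        by (rule alternatingI[of "[:0, 1:]"]) (auto simp: coeff_pCons map_poly_pCons pcompose_pCons split: nat.split)
      ultimately have "alternating (1 + length ?bs) ([:0, 1:] * P ?bs)"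
        by (intro alternating_mult)
      then show ?thesis
        by (simp only: Pas len plus_1_eq_Suc)
    next
      case False
      then have "a \<noteq> 0" using a by auto
      have root: "poly (P xs) b = 0 \<longleftrightarrow> b \<in> set xs" for xs b
        by (induction xs) (auto simp: P_def)
      have "poly (P as \<circ>\<^sub>p [:0, -1:]) a = 0"
        using 1(2) root[of as a] a by simp
      then have "- a \<in> set as"
        by (simp add: poly_pcompose root)
      then have neg: "- a \<in> set (remove1 a as)"
        using \<open>a \<noteq> 0\<close> by (simp add: in_set_remove1)
      let ?bs = "remove1 (- a) (remove1 a as)" and ?q = "[:- (a\<^sup>2), 0, 1:]"
      have len: "length as = 2 + length ?bs"
      proof -
        have "length (remove1 a as) > 0" using neg by (rule length_pos_if_in_set)
        then show ?thesis using a neg by (simp add: length_remove1)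
      qed
      have Pas: "P as = ?q * P ?bs"
      proof -
        have "P as = ([:- a, 1:] * [:a, 1:]) * P ?bs"
          using remove[OF a] remove[OF neg] by (simp only: mult.assoc minus_minus)
        then show ?thesis by (simp add: power2_eq_square)
      qed
      have "?q * (P ?bs \<circ>\<^sub>p [:0, -1:]) = ?q * Polynomial.smult ((-1) ^ length ?bs) (P ?bs)"
      proof -
        have "?q \<circ>\<^sub>p [:0, -1:] = ?q"
          by (simp add: pcompose_pCons)
        then have "?q * (P ?bs \<circ>\<^sub>p [:0, -1:]) = P as \<circ>\<^sub>p [:0, -1:]"
          by (simp only: Pas pcompose_mult)
        also have "\<dots> = ?q * Polynomial.smult ((-1) ^ length ?bs) (P ?bs)"
          using 1(2) by (simp only: Pas len mult_smult_right power_add) simp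
        finally show ?thesis .
      qed
      then have "P ?bs \<circ>\<^sub>p [:0, -1:] = Polynomial.smult ((-1) ^ length ?bs) (P ?bs)"
        by (subst (asm) mult_left_cancel) auto
      then have "alternating (length ?bs) (P ?bs)"
        using 1(1) len by simp
      \<comment> \<open>The substitution x -> i x turns x^2 - a^2 into i^2 (x^2 + a^2), which
        supplies the witness.\<close>
      moreover have "alternating 2 ?q"
        by (rule alternatingI[of "[:a\<^sup>2, 0, 1:]"])
          (auto simp: coeff_pCons map_poly_pCons pcompose_pCons split: nat.split)
      ultimately have "alternating (2 + length ?bs) (?q * P ?bs)"
        by (intro alternating_mult)
      then show ?thesis
        by (simp only: Pas len)
    qed
  qed
qed

text \<open>For nonnegative x the value of \<phi>~ at x is the modulus of \<phi> at i x, and each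
  linear factor i x - a has modulus sqrt (x^2 + a^2).\<close>

lemma poly_map_abs_alternating:
  fixes as :: "real list"
  defines "P \<equiv> \<Prod>a\<leftarrow>as. [:- a, 1:]"
  assumes "alternating n P" "0 \<le> x"
  shows "poly (map_poly abs P) x = (\<Prod>a\<leftarrow>as. sqrt (x\<^sup>2 + a\<^sup>2))"
proof -
  have "0 \<le> poly (map_poly abs P) x"
    using assms(3) by (simp add: poly_altdef coeff_map_poly sum_nonneg)
  then have "poly (map_poly abs P) x = norm (poly (Polynomial.smult (\<i> ^ n) (map_poly complex_of_real (map_poly abs P))) (of_real x))"
    by (simp add: norm_mult norm_power of_real_hom.poly_map_poly)
  also have "\<dots> = norm (poly (map_poly complex_of_real P) (\<i> * of_real x))"
    by (subst alternating_abs[OF assms(2), symmetric]) (simp add: poly_pcompose mult.commute)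
  also have "poly (map_poly complex_of_real P) y = (\<Prod>a\<leftarrow>as. y - of_real a)" for y
    unfolding P_def by (induction as) (auto simp: of_real_poly_hom.hom_mult map_poly_pCons simp del: mult_pCons_left)
  also have "norm (\<Prod>a\<leftarrow>as. \<i> * of_real x - of_real a) = (\<Prod>a\<leftarrow>as. sqrt (x\<^sup>2 + a\<^sup>2))"
  proof -
    have "norm (\<i> * of_real x - of_real a) = sqrt (x\<^sup>2 + a\<^sup>2)" for a
      by (simp add: cmod_def add.commute)
    then show ?thesis
      by (induction as) (simp_all add: norm_mult)
  qed
  finally show ?thesis .
qed

section \<open>Real spectra of symmetric matrices and sums over their eigenvalues\<close>

lemma symmetric_char_poly_factorized:
  fixes A :: "real mat"
  assumes A: "A \<in> carrier_mat n n" and sym: "\<And>i j. i < n \<Longrightarrow> j < n \<Longrightarrow> A $$ (i, j) = A $$ (j, i)"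
  obtains as where "char_poly A = (\<Prod>a\<leftarrow>as. [:- a, 1:])" "length as = n"
proof -
  let ?B = "map_mat complex_of_real A"
  have B: "?B \<in> carrier_mat n n" using A by simp
  obtain cs where cs: "char_poly ?B = (\<Prod>c\<leftarrow>cs. [:- c, 1:])" "length cs = n"
    using char_poly_factorized[OF B] by blast
  \<comment> \<open>The characteristic polynomial splits over the complex numbers; the factorization
    descends to the reals once every root is known to be real.\<close>
  have real: "complex_of_real (Re c) = c" if "c \<in> set cs" for c
  proof -
    have "poly (\<Prod>c\<leftarrow>cs. [:- c, 1:]) c = 0"
      using that by (induction cs) auto
    then have "eigenvalue ?B c"
      by (simp add: eigenvalue_root_char_poly[OF B] cs(1))
    then obtain v where v: "v \<in> carrier_vec n" "v \<noteq> 0\<^sub>v n" "?B *\<^sub>v v = c \<cdot>\<^sub>v v"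
      unfolding eigenvalue_def eigenvector_def using A by auto
    let ?a = "\<lambda>i j. complex_of_real (A $$ (i, j))"
    let ?s = "\<Sum>i<n. v $ i * cnj (v $ i)"
    have row: "(\<Sum>j<n. ?a i j * v $ j) = c * v $ i" if "i < n" for i
    proof -
      have "(?B *\<^sub>v v) $ i = c * v $ i" using v that by simp
      then show ?thesis
        using A v(1) that by (simp add: scalar_prod_def atLeast0LessThan)
    qed
    \<comment> \<open>The Hermitian form of the matrix at \<open>v\<close> is evaluated in two ways.
      As the entries are real and symmetric, the results are \<open>c\<close> and its conjugate
      times the squared norm \<open>?s\<close>, which is nonzero.\<close>
    have "c * ?s = (\<Sum>i<n. (\<Sum>j<n. ?a i j * v $ j) * cnj (v $ i))"
      by (simp add: row sum_distrib_left mult.assoc)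
    also have "\<dots> = (\<Sum>i<n. \<Sum>j<n. ?a i j * v $ j * cnj (v $ i))"
      by (simp add: sum_distrib_right)
    also have "\<dots> = (\<Sum>j<n. \<Sum>i<n. ?a j i * v $ j * cnj (v $ i))"
      by (subst sum.swap) (intro sum.cong refl, simp add: sym)
    also have "\<dots> = (\<Sum>j<n. cnj (\<Sum>i<n. ?a j i * v $ i) * v $ j)"
      by (simp add: sum_distrib_left sum_distrib_right mult_ac)
    also have "\<dots> = (\<Sum>j<n. cnj (c * v $ j) * v $ j)"
      by (intro sum.cong refl) (simp only: row lessThan_iff)
    also have "\<dots> = cnj c * ?s"
      by (simp add: sum_distrib_left mult_ac)
    finally have "c * ?s = cnj c * ?s" .
    moreover have "?s \<noteq> 0"
    proof
      assume "?s = 0"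
      moreover have "?s = complex_of_real (\<Sum>i<n. (cmod (v $ i))\<^sup>2)"
        by (simp only: of_real_sum complex_norm_square)
      ultimately have "(\<Sum>i<n. (cmod (v $ i))\<^sup>2) = 0"
        by (metis of_real_eq_0_iff)
      then have "\<forall>i<n. v $ i = 0"
        by (subst (asm) sum_nonneg_eq_0_iff) auto
      then show False
        using v(1,2) by auto
    qed
    ultimately have "c = cnj c" by simp
    then show ?thesis
      by (simp add: complex_eq_iff)
  qed
  have "map_poly complex_of_real (char_poly A) = char_poly ?B"
    by (rule of_real_hom.char_poly_hom[OF A, symmetric])
  also have "\<dots> = (\<Prod>c\<leftarrow>cs. [:- of_real (Re c), 1:])"
    unfolding cs(1) using real by (intro arg_cong[of _ _ prod_list] map_cong refl) auto
  also have "\<dots> = map_poly complex_of_real (\<Prod>a\<leftarrow>map Re cs. [:- a, 1:])"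
    by (induction cs) (auto simp: of_real_poly_hom.hom_mult map_poly_pCons simp del: mult_pCons_left)
  finally have "char_poly A = (\<Prod>a\<leftarrow>map Re cs. [:- a, 1:])"
    by (simp only: of_real_poly_hom.eq_iff)
  then show thesis
    using that cs(2) by (metis length_map)
qed

lemma sum_list_eq_sum_count_list:
  fixes f :: "'b \<Rightarrow> real"
  assumes "finite X" "set xs \<subseteq> X"
  shows "(\<Sum>x\<leftarrow>xs. f x) = (\<Sum>x\<in>X. real (count_list xs x) * f x)"
  using assms(2)
proof (induction xs)
  case (Cons a xs)
  have "(\<Sum>x\<in>X. real (count_list (a # xs) x) * f x)
      = (\<Sum>x\<in>X. (if x = a then f x else 0) + real (count_list xs x) * f x)"
    by (intro sum.cong) (auto simp: algebra_simps)
  also have "\<dots> = f a + (\<Sum>x\<leftarrow>xs. f x)"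
    using Cons assms(1) by (simp add: sum.distrib)
  finally show ?case by simp
qed simp

text \<open>The order of a root is its number of occurrences in the list. This converts the weighted
  sum over distinct eigenvalues in \<open>graph_energy\<close> into a plain sum over the list of
  roots.\<close>

lemma spectrum_sum_eq_sum_list:
  fixes A :: "real mat"
  assumes A: "A \<in> carrier_mat n n" and as: "char_poly A = (\<Prod>a\<leftarrow>as. [:- a, 1:])"
  shows "(\<Sum>a\<in>spectrum A. real (order a (char_poly A)) * f a) = (\<Sum>a\<leftarrow>as. f a)"
proof -
  have "poly (\<Prod>a\<leftarrow>as. [:- a, 1:]) b = 0 \<longleftrightarrow> b \<in> set as" for b
    by (induction as) auto
  moreover have "spectrum A = {b. poly (char_poly A) b = 0}"
    unfolding spectrum_def by (intro Collect_cong eigenvalue_root_char_poly[OF A])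
  ultimately have "spectrum A = set as"
    by (simp only: as Collect_mem_eq)
  moreover have "order b (char_poly A) = count_list as b" for b
  proof -
    have "(\<Sum>p\<leftarrow>map (\<lambda>a. [:- a, 1:]) as. order b p) = count_list as b"
      by (induction as) (auto simp: order_linear')
    then show ?thesis
      unfolding as by (subst order_prod_list) auto
  qed
  ultimately show ?thesis
    by (simp add: sum_list_eq_sum_count_list[of "set as"])
qed

section \<open>Coulson's integral formula\<close>

text \<open>Subtracting the term for the root 1 removes the logarithmic growth at infinity, so the
  integral converges. An explicit antiderivative then yields its value from the limits at 0 and
  infinity.\<close>

lemma coulson_root_integral_nonneg:
  fixes a :: real
  assumes "0 \<le> a"
  defines "f \<equiv> \<lambda>x::real. (ln (x\<^sup>2 + a\<^sup>2) - ln (x\<^sup>2 + 1)) / 2"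
  shows "set_integrable lborel {0<..} f" and "(LBINT x:{0<..}. f x) = pi / 2 * (a - 1)"
proof -
  \<comment> \<open>Integration by parts: - x f'(x) = a^2 / (x^2 + a^2) - 1 / (x^2 + 1), whose
    antiderivative supplies the two arctan terms. For \<open>a = 0\<close> the first of them is
    0.\<close>
  define F where "F = (\<lambda>x::real. x * ((ln (x\<^sup>2 + a\<^sup>2) - ln (x\<^sup>2 + 1)) / 2) + a * arctan (x / a) - arctan x)"
  have pos: "0 < x\<^sup>2 + a\<^sup>2" if "0 < x" for x :: real
    using that by (simp add: add_pos_nonneg)
  have pos1: "0 < x\<^sup>2 + 1" for x :: real
    by (simp add: add_nonneg_pos)
  have ivl: "einterval 0 \<infinity> = {0<..}"
    by (auto simp: einterval_def)
  have deriv: "(F has_real_derivative f x) (at x)" if "0 < x" for x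
  proof -
    have "(f has_real_derivative (2 * x / (x\<^sup>2 + a\<^sup>2) - 2 * x / (x\<^sup>2 + 1)) / 2) (at x)"
      unfolding f_def using pos[OF that] pos1[of x] by (auto intro!: derivative_eq_intros)
    from DERIV_mult[OF DERIV_ident this]
    have "((\<lambda>x. x * ((ln (x\<^sup>2 + a\<^sup>2) - ln (x\<^sup>2 + 1)) / 2)) has_real_derivative
        f x + x * (2 * x / (x\<^sup>2 + a\<^sup>2) - 2 * x / (x\<^sup>2 + 1)) / 2) (at x)"
      by (simp add: f_def mult.commute)
    moreover have "((\<lambda>x. a * arctan (x / a)) has_real_derivative a\<^sup>2 / (x\<^sup>2 + a\<^sup>2)) (at x)"
    proof (cases "a = 0")
      case False
      have "((\<lambda>x. a * arctan (x / a)) has_real_derivative a * ((1 / a) / (1 + (x / a)\<^sup>2))) (at x)"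
        using False by (auto intro!: derivative_eq_intros simp: inverse_eq_divide)
      also have "a * ((1 / a) / (1 + (x / a)\<^sup>2)) = a\<^sup>2 / (x\<^sup>2 + a\<^sup>2)"
      proof -
        have "1 + (x / a)\<^sup>2 = (x\<^sup>2 + a\<^sup>2) / a\<^sup>2"
          using False by (simp add: field_simps)
        then show ?thesis using False by simp
      qed
      finally show ?thesis .
    qed simp
    moreover have "(arctan has_real_derivative 1 / (x\<^sup>2 + 1)) (at x)"
      by (auto intro!: derivative_eq_intros simp: inverse_eq_divide add.commute)
    ultimately have "(F has_real_derivative
       f x + x * (2 * x / (x\<^sup>2 + a\<^sup>2) - 2 * x / (x\<^sup>2 + 1)) / 2 + a\<^sup>2 / (x\<^sup>2 + a\<^sup>2) - 1 / (x\<^sup>2 + 1)) (at x)"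
      unfolding F_def by (intro DERIV_add DERIV_diff)
    moreover have "x * (2 * x / (x\<^sup>2 + a\<^sup>2) - 2 * x / (x\<^sup>2 + 1)) / 2 + a\<^sup>2 / (x\<^sup>2 + a\<^sup>2) - 1 / (x\<^sup>2 + 1) = 0"
    proof -
      have "x * (2 * x / p - 2 * x / q) / 2 + a\<^sup>2 / p - 1 / q = (x\<^sup>2 + a\<^sup>2) / p - (x\<^sup>2 + 1) / q" for p q
        by (simp add: add_divide_distrib diff_divide_distrib right_diff_distrib power2_eq_square)
      then show ?thesis using that pos1[of x] by simp
    qed
    ultimately show ?thesis
      by (simp add: algebra_simps)
  qed
  have cont: "isCont f x" if "0 < x" for x
    unfolding f_def using pos[OF that] pos1[of x] by (intro continuous_intros) auto
  have lim0: "(F \<longlongrightarrow> 0) (at_right 0)"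
  proof (cases "a = 0")
    case True
    show ?thesis unfolding F_def True by simp real_asymp
  next
    case False
    then have "0 < a" using assms by simp
    then show ?thesis unfolding F_def by real_asymp
  qed
  have limI: "(F \<longlongrightarrow> pi / 2 * (a - 1)) at_top"
  proof (cases "a = 0")
    case True
    show ?thesis unfolding F_def True by simp real_asymp
  next
    case False
    then have "0 < a" using assms by simp
    then show ?thesis unfolding F_def by real_asymp (simp add: algebra_simps)
  qed
  \<comment> \<open>On the positive axis \<open>f\<close> has constant sign, determined by whether
    \<open>a\<close> is at least 1. The fundamental theorem for nonnegative integrands, applied to
    \<open>f\<close> or to its negative, gives integrability together with the value.\<close>
  have ftc: "set_integrable lborel {0<..} f \<and> (LBINT x:{0<..}. f x) = pi / 2 * (a - 1)"
  proof (cases "1 \<le> a")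
    case True
    then have "1 \<le> a\<^sup>2" by simp
    then have nn: "0 \<le> f x" if "0 < x" for x
      unfolding f_def using pos[OF that] pos1[of x] by simp
    have A: "((F \<circ> real_of_ereal) \<longlongrightarrow> 0) (at_right 0)"
      using lim0 unfolding zero_ereal_def ereal_tendsto_simps .
    have B: "((F \<circ> real_of_ereal) \<longlongrightarrow> pi / 2 * (a - 1)) (at_left \<infinity>)"
      using limI unfolding ereal_tendsto_simps .
    have z: "(0::ereal) < \<infinity>" by simp
    note ftc = interval_integral_FTC_nonneg[of 0 \<infinity> F f, OF z _ _ _ A B]
    show ?thesis
      using ftc deriv cont nn
      by (auto simp: ivl interval_lebesgue_integral_def)
  next
    case False
    then have "a\<^sup>2 \<le> 1" using assms by (simp add: abs_square_le_1)
    then have nn: "0 \<le> - f x" if "0 < x" for x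
      unfolding f_def using pos[OF that] pos1[of x] by simp
    have A: "(((\<lambda>x. - F x) \<circ> real_of_ereal) \<longlongrightarrow> - 0) (at_right 0)"
      using tendsto_minus[OF lim0] unfolding zero_ereal_def ereal_tendsto_simps .
    have B: "(((\<lambda>x. - F x) \<circ> real_of_ereal) \<longlongrightarrow> - (pi / 2 * (a - 1))) (at_left \<infinity>)"
      using tendsto_minus[OF limI] unfolding ereal_tendsto_simps .
    have z: "(0::ereal) < \<infinity>" by simp
    note ftc = interval_integral_FTC_nonneg[of 0 \<infinity> "\<lambda>x. - F x" "\<lambda>x. - f x", OF z _ _ _ A B]
    have "set_integrable lborel {0<..} (\<lambda>x. - f x)" "(LBINT x:{0<..}. - f x) = - (pi / 2 * (a - 1))"
      using ftc deriv cont nn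
      by (auto simp: ivl interval_lebesgue_integral_def intro!: DERIV_minus)
    then show ?thesis
      by (simp add: set_integrable_def set_lebesgue_integral_def)
  qed
  show "set_integrable lborel {0<..} f" "(LBINT x:{0<..}. f x) = pi / 2 * (a - 1)"
    using ftc by simp_all
qed

lemma coulson_root_integral:
  fixes a :: real
  defines "f \<equiv> \<lambda>x::real. ln (sqrt (x\<^sup>2 + a\<^sup>2)) - ln (sqrt (x\<^sup>2 + 1))"
  shows "set_integrable lborel {0<..} f" and "(LBINT x:{0<..}. f x) = pi / 2 * (\<bar>a\<bar> - 1)"
proof -
  have "f = (\<lambda>x. (ln (x\<^sup>2 + \<bar>a\<bar>\<^sup>2) - ln (x\<^sup>2 + 1)) / 2)" 
    by (auto simp: f_def fun_eq_iff ln_sqrt diff_divide_distrib add_nonneg_eq_0_iff add_nonneg_nonneg)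
  then show "set_integrable lborel {0<..} f" and "(LBINT x:{0<..}. f x) = pi / 2 * (\<bar>a\<bar> - 1)"
    using coulson_root_integral_nonneg[of "\<bar>a\<bar>"] by simp_all
qed

text \<open>The logarithm of the product splits into one term per root; the normalisation, taken
  once per root, makes each term integrable separately.\<close>

lemma coulson_integral:
  fixes as :: "real list"
  defines "f \<equiv> \<lambda>x::real. ln (\<Prod>a\<leftarrow>as. sqrt (x\<^sup>2 + a\<^sup>2)) - real (length as) * ln (sqrt (x\<^sup>2 + 1))"
  shows "set_integrable lborel {0<..} f"
    and "(LBINT x:{0<..}. f x) = pi / 2 * ((\<Sum>a\<leftarrow>as. \<bar>a\<bar>) - real (length as))"
proof -
  let ?g = "\<lambda>a x::real. ln (sqrt (x\<^sup>2 + a\<^sup>2)) - ln (sqrt (x\<^sup>2 + 1))"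
  let ?G = "\<lambda>as x. \<Sum>a\<leftarrow>as. ?g a x"
  have ln_prod: "f x = ?G as x" if "0 < x" for x
  proof -
    have pos: "0 < sqrt (x\<^sup>2 + a\<^sup>2)" for a
      using that by (simp add: add_pos_nonneg)
    have "0 < (\<Prod>a\<leftarrow>bs. sqrt (x\<^sup>2 + a\<^sup>2))" for bs
      using pos by (induction bs) (auto simp del: real_sqrt_gt_0_iff)
    then have "ln (\<Prod>a\<leftarrow>bs. sqrt (x\<^sup>2 + a\<^sup>2)) - real (length bs) * ln (sqrt (x\<^sup>2 + 1)) = ?G bs x" for bs
      using pos by (induction bs) (auto simp: ln_mult_pos algebra_simps simp del: real_sqrt_gt_0_iff)
    then show ?thesis by (simp add: f_def)
  qed
  have "set_integrable lborel {0<..} (?G as) \<and>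
      (LBINT x:{0<..}. ?G as x) = pi / 2 * ((\<Sum>a\<leftarrow>as. \<bar>a\<bar>) - real (length as))"
  proof (induction as)
    case Nil
    then show ?case by (simp add: set_integrable_def set_lebesgue_integral_def)
  next
    case (Cons a as)
    note IH = Cons.IH[THEN conjunct1] Cons.IH[THEN conjunct2]
    note hd = coulson_root_integral[of a]
    have "?G (a # as) = (\<lambda>x. ?g a x + ?G as x)" by simp
    then show ?case
      using set_integral_add[OF hd(1) IH(1)] hd(2) IH(2) by (simp only: list.map sum_list.Cons) (simp add: field_simps)
  qed
  moreover have "set_integrable lborel {0<..} f = set_integrable lborel {0<..} (?G as)"
    using ln_prod by (intro set_integrable_cong) auto
  moreover have "(LBINT x:{0<..}. f x) = (LBINT x:{0<..}. ?G as x)"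
    using ln_prod by (intro set_lebesgue_integral_cong) auto
  ultimately show "set_integrable lborel {0<..} f"
    and "(LBINT x:{0<..}. f x) = pi / 2 * ((\<Sum>a\<leftarrow>as. \<bar>a\<bar>) - real (length as))"
    by simp_all
qed

section \<open>Coulson's formula for bipartite graphs\<close>

lemma bipartite_char_poly_factorized:
  assumes "pair_graph G" "bipartite G"
  defines "P \<equiv> char_poly (adjacency_matrix G)"
  obtains as where "P = (\<Prod>a\<leftarrow>as. [:- a, 1:])" "length as = card (pverts G)"
    "alternating (card (pverts G)) P"
proof -
  interpret pair_graph G by fact
  let ?A = "adjacency_matrix G" and ?n = "card (pverts G)"
  have A: "?A \<in> carrier_mat ?n ?n"
    by (simp add: adjacency_matrix_def Let_def)
  have "?A $$ (i, j) = ?A $$ (j, i)" if "i < ?n" "j < ?n" for i j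
    using that arcs_symmetric by (auto simp: adjacency_matrix_def Let_def)
  from symmetric_char_poly_factorized[OF A this]
  obtain as where as: "P = (\<Prod>a\<leftarrow>as. [:- a, 1:])" "length as = ?n"
    unfolding P_def by blast
  obtain X Y where XY: "pverts G = X \<union> Y" "X \<inter> Y = {}"
      "\<forall>(x, y) \<in> parcs G. x \<in> X \<and> y \<in> Y \<or> x \<in> Y \<and> y \<in> X"
    using assms(2) unfolding bipartite_def by blast
  have "x \<in> X \<longleftrightarrow> y \<notin> X" if "(x, y) \<in> parcs G" for x y
    using XY that by auto
  \<comment> \<open>Symmetry of the matrix gave real roots; the bipartition now gives the reflection
    law, and together they make \<open>P\<close> alternating.\<close>
  then have "P \<circ>\<^sub>p [:0, -1:] = Polynomial.smult ((-1) ^ ?n) P"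
    unfolding P_def char_poly_adjacency_matrix[OF pair_finite_verts]
    by (intro char_poly_on_bipartite_reflect[of _ _ X] pair_finite_verts)
  then have "alternating ?n P"
    using alternating_real_roots[of as] as by simp
  then show thesis using that as by blast
qed

lemma coulson_integral_graph:
  assumes "pair_graph G" "bipartite G"
  defines "f \<equiv> \<lambda>x. ln (poly (abs_char_poly G) x) - real (card (pverts G)) * ln (sqrt (x\<^sup>2 + 1))"
  shows "0 < x \<Longrightarrow> 0 < poly (abs_char_poly G) x"
    and "set_integrable lborel {0<..} f"
    and "(LBINT x:{0<..}. f x) = pi / 2 * (graph_energy G - real (card (pverts G)))"
proof -
  let ?A = "adjacency_matrix G" and ?n = "card (pverts G)"
  have A: "?A \<in> carrier_mat ?n ?n"
    by (simp add: adjacency_matrix_def Let_def)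
  obtain as where as: "char_poly ?A = (\<Prod>a\<leftarrow>as. [:- a, 1:])" "length as = ?n"
    "alternating ?n (char_poly ?A)"
    using bipartite_char_poly_factorized[OF assms(1,2)] by blast
  have abs: "poly (abs_char_poly G) x = (\<Prod>a\<leftarrow>as. sqrt (x\<^sup>2 + a\<^sup>2))" if "0 < x" for x
    using poly_map_abs_alternating[of ?n as x] as that by (simp add: abs_char_poly_def)
  show "0 < poly (abs_char_poly G) x" if "0 < x"
  proof -
    have "0 < sqrt (x\<^sup>2 + a\<^sup>2)" for a
      using that by (simp add: add_pos_nonneg)
    then have "0 < (\<Prod>a\<leftarrow>as. sqrt (x\<^sup>2 + a\<^sup>2))"
      by (induction as) (auto simp del: real_sqrt_gt_0_iff)
    then show ?thesis using abs[OF that] by simp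
  qed
  let ?g = "\<lambda>x. ln (\<Prod>a\<leftarrow>as. sqrt (x\<^sup>2 + a\<^sup>2)) - real (length as) * ln (sqrt (x\<^sup>2 + 1))"
  have fg: "f x = ?g x" if "0 < x" for x
    using abs[OF that] by (simp add: f_def as(2))
  have "graph_energy G = (\<Sum>a\<leftarrow>as. \<bar>a\<bar>)"
    unfolding graph_energy_def by (rule spectrum_sum_eq_sum_list[OF A as(1)])
  moreover have "set_integrable lborel {0<..} f \<longleftrightarrow> set_integrable lborel {0<..} ?g"
    using fg by (intro set_integrable_cong) auto
  moreover have "(LBINT x:{0<..}. f x) = (LBINT x:{0<..}. ?g x)"
    using fg by (intro set_lebesgue_integral_cong) auto
  ultimately show "set_integrable lborel {0<..} f"
    and "(LBINT x:{0<..}. f x) = pi / 2 * (graph_energy G - real ?n)"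
    using coulson_integral[of as] as(2) by simp_all
qed

text \<open>The normalising terms depend only on the order, so for graphs of equal order they cancel
  on both sides.\<close>

lemma coulson_energy_difference:
  assumes G: "pair_graph G" "bipartite G" and H: "pair_graph H" "bipartite H"
    and card: "card (pverts H) = card (pverts G)"
  defines "f \<equiv> \<lambda>x. ln (poly (abs_char_poly H) x / poly (abs_char_poly G) x)"
  shows "set_integrable lborel {0<..} f"
    and "graph_energy H - graph_energy G = 2 / pi * (LBINT x:{0<..}. f x)"
proof -
  let ?f = "\<lambda>P n x. ln (poly P x) - real n * ln (sqrt (x\<^sup>2 + 1))"
  let ?g = "\<lambda>x. ?f (abs_char_poly H) (card (pverts H)) x - ?f (abs_char_poly G) (card (pverts G)) x"
  have fg: "f x = ?g x" if "0 < x" for x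
    using coulson_integral_graph(1)[OF G that] coulson_integral_graph(1)[OF H that]
    by (simp add: f_def card ln_div)
  note int = set_integral_diff[OF coulson_integral_graph(2)[OF H] coulson_integral_graph(2)[OF G]]
  have "set_integrable lborel {0<..} f \<longleftrightarrow> set_integrable lborel {0<..} ?g"
    using fg by (intro set_integrable_cong) auto
  then show "set_integrable lborel {0<..} f"
    using int(1) by blast
  have "(LBINT x:{0<..}. f x) = (LBINT x:{0<..}. ?g x)"
    using fg by (intro set_lebesgue_integral_cong) auto
  also note int(2)
  also note coulson_integral_graph(3)[OF H]
  also note coulson_integral_graph(3)[OF G]
  finally show "graph_energy H - graph_energy G = 2 / pi * (LBINT x:{0<..}. f x)"
    by (simp add: card field_simps)
qed

section \<open>The recurrence for \<phi>~ and the comparison of quotients\<close>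

lemma abs_char_poly_subdivision_rec:
  assumes "pair_graph G" "bipartite G" "cut_edge G e"
  defines "Q \<equiv> \<lambda>k. abs_char_poly (subdivision_graph G e k)"
  shows "Q (Suc (Suc k)) = [:0, 1:] * Q (Suc k) + Q k"
proof -
  let ?n = "card (pverts G)"
  let ?P = "\<lambda>k. char_poly (adjacency_matrix (subdivision_graph G e k))"
  let ?c = "map_poly complex_of_real"
  have "alternating (?n + k) (?P k)" for k
    using bipartite_char_poly_factorized[of "subdivision_graph G e k"] assms
    by (metis bipartite_subdivision_graph card_pverts_subdivision_graph cut_edge_def
        pair_graph_subdivision_graph)
  then have rot: "?c (?P k) \<circ>\<^sub>p [:0, \<i>:] = Polynomial.smult (\<i> ^ (?n + k)) (?c (Q k))" for k
    unfolding Q_def abs_char_poly_def by (rule alternating_abs)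
  have X: "?c [:0, 1:] \<circ>\<^sub>p [:0, \<i>:] = Polynomial.smult \<i> [:0, 1:]"
    by (simp add: map_poly_pCons pcompose_pCons)
  have smult_cancel: "p = q" if "Polynomial.smult (\<i> ^ m) p = Polynomial.smult (\<i> ^ m) q" for p q m
  proof (rule poly_eqI)
    fix j
    have "coeff (Polynomial.smult (\<i> ^ m) p) j = coeff (Polynomial.smult (\<i> ^ m) q) j"
      by (simp only: that)
    then show "coeff p j = coeff q j" by simp
  qed
  have i_mult_i: "\<i> * (z * \<i>) = - z" for z
    by (simp add: mult.left_commute[of \<i>])
  have "?c (?P (Suc (Suc k))) \<circ>\<^sub>p [:0, \<i>:]
      = (?c [:0, 1:] \<circ>\<^sub>p [:0, \<i>:]) * (?c (?P (Suc k)) \<circ>\<^sub>p [:0, \<i>:]) - ?c (?P k) \<circ>\<^sub>p [:0, \<i>:]"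
    by (simp only: char_poly_subdivision_rec[OF assms(1,3)] of_real_poly_hom.hom_mult
        of_real_poly_hom.hom_minus pcompose_mult pcompose_diff)
  \<comment> \<open>The powers of \<open>\<i>\<close> are \<open>?n + k + 2\<close> on the left, the
    same for the product with x, and \<open>?n + k\<close> for the last term. Taking out
    \<open>\<i> ^ (?n + k)\<close> negates the first two, so after division by -1 the minus sign of
    the recurrence becomes a plus.\<close>
  then have "Polynomial.smult (\<i> ^ (?n + k)) (- ?c (Q (Suc (Suc k))))
      = Polynomial.smult (\<i> ^ (?n + k)) (- ([:0, 1:] * ?c (Q (Suc k)) + ?c (Q k)))"
    unfolding rot X by (simp add: smult_diff_right smult_add_right mult.assoc i_mult_i)
  then have "- ?c (Q (Suc (Suc k))) = - ([:0, 1:] * ?c (Q (Suc k)) + ?c (Q k))"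
    by (rule smult_cancel)
  then have "?c (Q (Suc (Suc k))) = [:0, 1:] * ?c (Q (Suc k)) + ?c (Q k)"
    by (simp only: neg_equal_iff_equal)
  also have "\<dots> = ?c ([:0, 1:] * Q (Suc k) + Q k)"
    by (simp add: of_real_poly_hom.hom_mult of_real_poly_hom.hom_add map_poly_pCons del: mult_pCons_left)
  finally show ?thesis
    by (simp only: of_real_poly_hom.eq_iff)
qed

text \<open>Under a common linear recurrence with nonnegative coefficients, each new quotient is a mediant
  of the two preceding ones.\<close>

lemma quotient_rec_ge_min:
  fixes p q :: "nat \<Rightarrow> real"
  assumes x: "0 < x" and q: "\<And>k. 0 < q k"
    and rec: "\<And>k. p (Suc (Suc k)) = x * p (Suc k) + p k" "\<And>k. q (Suc (Suc k)) = x * q (Suc k) + q k"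
  shows "min (p 0 / q 0) (p 1 / q 1) \<le> p k / q k"
proof -
  define m where "m = min (p 0 / q 0) (p 1 / q 1)"
  \<comment> \<open>With denominators multiplied out the bound is linear and survives nonnegative
    combinations; two consecutive indices are carried because the recurrence has order two.\<close>
  have "m * q k \<le> p k \<and> m * q (Suc k) \<le> p (Suc k)"
  proof (induction k)
    case 0
    have "m \<le> p 0 / q 0" "m \<le> p 1 / q 1" by (simp_all add: m_def)
    then show ?case using q by (simp add: pos_le_divide_eq)
  next
    case (Suc k)
    then have "x * (m * q (Suc k)) \<le> x * p (Suc k)"
      using x by (intro mult_left_mono) auto
    then show ?case using Suc by (simp add: rec algebra_simps)
  qed
  then have "m \<le> p k / q k"
    using q[of k] by (simp add: pos_le_divide_eq)
  then show ?thesis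
    by (simp only: m_def)
qed

theorem theorem3p3:
  fixes G :: "'a pair_pre_digraph" and H :: "'b pair_pre_digraph"
    and e :: "'a \<times> 'a" and e' :: "'b \<times> 'b" and n :: nat
    and d :: "nat \<Rightarrow> real \<Rightarrow> real" and D DC :: "real set"
  assumes "pair_graph G" and "bipartite G" and "card (pverts G) = n" and "cut_edge G e"
    and "pair_graph H" and "bipartite H" and "card (pverts H) = n" and "cut_edge H e'"
  defines "d \<equiv> \<lambda>k x. poly (abs_char_poly (subdivision_graph H e' k)) x
                    / poly (abs_char_poly (subdivision_graph G e k)) x"
    and "D \<equiv> {x. 0 < x \<and> d 0 x > d 1 x}"
    and "DC \<equiv> {0<..} - D"
  shows
    "set_integrable lborel {0<..} (\<lambda>x. ln (min (d 0 x) (d 1 x)))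
     \<and> set_integrable lborel D (\<lambda>x. ln (d 1 x))
     \<and> set_integrable lborel DC (\<lambda>x. ln (d 0 x))
     \<and> set_integrable lborel DC (\<lambda>x. ln (d 1 x / d 0 x))
     \<and> set_integrable lborel D (\<lambda>x. ln (d 1 x / d 0 x))
     \<and> (\<forall>k. graph_energy (subdivision_graph H e' k) - graph_energy (subdivision_graph G e k)
            \<ge> 2 / pi * (LBINT x:{0<..}. ln (min (d 0 x) (d 1 x))))
     \<and> 2 / pi * (LBINT x:{0<..}. ln (min (d 0 x) (d 1 x)))
         = 2 / pi * (LBINT x:D. ln (d 1 x)) + 2 / pi * (LBINT x:DC. ln (d 0 x))
     \<and> 2 / pi * (LBINT x:D. ln (d 1 x)) + 2 / pi * (LBINT x:DC. ln (d 0 x))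
         = graph_energy (subdivision_graph H e' 1) - graph_energy (subdivision_graph G e 1)
           - 2 / pi * (LBINT x:DC. ln (d 1 x / d 0 x))
     \<and> graph_energy (subdivision_graph H e' 1) - graph_energy (subdivision_graph G e 1)
           - 2 / pi * (LBINT x:DC. ln (d 1 x / d 0 x))
         = graph_energy (subdivision_graph H e' 0) - graph_energy (subdivision_graph G e 0)
           + 2 / pi * (LBINT x:D. ln (d 1 x / d 0 x))"
proof -
  let ?G = "subdivision_graph G e" and ?H = "subdivision_graph H e'"
  have G: "pair_graph (?G k)" "bipartite (?G k)" and H: "pair_graph (?H k)" "bipartite (?H k)"
    and card: "card (pverts (?H k)) = card (pverts (?G k))" for k
    using assms(1-8)
    by (auto simp: card_pverts_subdivision_graph bipartite_subdivision_graph cut_edge_def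
        intro: pair_graph_subdivision_graph)
  have int: "set_integrable lborel {0<..} (\<lambda>x. ln (d k x))"
    and energy: "graph_energy (?H k) - graph_energy (?G k) = 2 / pi * (LBINT x:{0<..}. ln (d k x))" for k
    unfolding d_def using coulson_energy_difference[OF G H card] by blast+
  have pos: "0 < d k x" if "0 < x" for k x
    unfolding d_def using coulson_integral_graph(1)[OF G that] coulson_integral_graph(1)[OF H that] by simp
  have d_ge: "min (d 0 x) (d 1 x) \<le> d k x" if "0 < x" for k x
    unfolding d_def
    by (rule quotient_rec_ge_min[OF that])
      (use that assms(1-8) in \<open>auto simp: abs_char_poly_subdivision_rec coulson_integral_graph(1)[OF G]\<close>)
  have D: "D \<subseteq> {0<..}" "DC \<subseteq> {0<..}" "{0<..} = D \<union> DC" "D \<inter> DC = {}"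
    by (auto simp: D_def DC_def)
  have meas: "D \<in> sets lborel" "DC \<in> sets lborel"
  proof -
    have d_meas: "d k \<in> borel_measurable borel" for k
    proof -
      have "poly P \<in> borel_measurable borel" for P :: "real poly"
        by (intro borel_measurable_continuous_onI continuous_intros)
      then show ?thesis unfolding d_def by measurable
    qed
    have "D = {x \<in> space borel. 0 < x \<and> d 1 x < d 0 x}" by (auto simp: D_def)
    also have "\<dots> \<in> sets borel" using d_meas[of 0] d_meas[of 1] by measurable
    finally show "D \<in> sets lborel" by simp
    then show "DC \<in> sets lborel" by (simp add: DC_def)
  qed
  \<comment> \<open>Integrability is recorded on both pieces because a non-integrable function has
    the default integral 0, for which additivity could fail.\<close>
  note intD = set_integrable_subset[OF int meas(1) D(1)]
  note intDC = set_integrable_subset[OF int meas(2) D(2)]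
  have cong: "set_integrable lborel B f" "(LBINT x:B. f x) = (LBINT x:B. g x)"
    if "B \<in> sets lborel" "set_integrable lborel B g" "\<And>x. x \<in> B \<Longrightarrow> f x = g x"
    for B and f g :: "real \<Rightarrow> real"
    using that set_integrable_cong[of lborel lborel B B f g]
      set_lebesgue_integral_cong[of B lborel f g] by auto
  have split: "(LBINT x:{0<..}. f x) = (LBINT x:D. f x) + (LBINT x:DC. f x)"
    if "set_integrable lborel D f" "set_integrable lborel DC f" for f :: "real \<Rightarrow> real"
    unfolding D(3) using set_integral_Un[OF D(4) that] .
  let ?m = "\<lambda>x. ln (min (d 0 x) (d 1 x))"
  \<comment> \<open>The minimum is \<open>d 1\<close> on \<open>D\<close> and \<open>d 0\<close> on
    \<open>DC\<close>; points where both agree lie in \<open>DC\<close>.\<close>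
  have m_D: "?m x = ln (d 1 x)" if "x \<in> D" for x using that by (simp add: D_def)
  have m_DC: "?m x = ln (d 0 x)" if "x \<in> DC" for x using that by (auto simp: D_def DC_def min_def)
  note mD = cong[OF meas(1) intD m_D] and mDC = cong[OF meas(2) intDC m_DC]
  have int_m: "set_integrable lborel {0<..} ?m"
    unfolding D(3) by (intro set_integrable_Un mD mDC meas)
  have q: "ln (d 1 x / d 0 x) = ln (d 1 x) - ln (d 0 x)" if "x \<in> {0<..}" for x
    using that pos[of x 0] pos[of x 1] by (simp add: ln_div)
  note dD = set_integral_diff[OF intD[of 1] intD[of 0]]
  note dDC = set_integral_diff[OF intDC[of 1] intDC[of 0]]
  note qD = cong[OF meas(1) dD(1) q[OF subsetD[OF D(1)]]]
  note qDC = cong[OF meas(2) dDC(1) q[OF subsetD[OF D(2)]]]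
  \<comment> \<open>By Coulson's formula the energy difference is an integral of
    \<open>ln (d k x)\<close>, so the pointwise mediant bound can be integrated.\<close>
  have lower: "2 / pi * (LBINT x:{0<..}. ?m x) \<le> graph_energy (?H k) - graph_energy (?G k)" for k
    unfolding energy
  proof (intro mult_left_mono set_integral_mono int_m int)
    fix x :: real assume "x \<in> {0<..}"
    then have "0 < x" by simp
    then show "?m x \<le> ln (d k x)"
      using d_ge[of x k] pos[of x] by simp
  qed simp
  have min_eq: "(LBINT x:{0<..}. ?m x) = (LBINT x:D. ln (d 1 x)) + (LBINT x:DC. ln (d 0 x))"
    using split[OF mD(1) mDC(1)] mD(2) mDC(2) by simp
  have E: "graph_energy (?H k) - graph_energy (?G k)
      = 2 / pi * (LBINT x:D. ln (d k x)) + 2 / pi * (LBINT x:DC. ln (d k x))" for k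
    unfolding energy split[OF intD intDC] by (rule distrib_left)
  have quot: "(LBINT x:D. ln (d 1 x / d 0 x)) = (LBINT x:D. ln (d 1 x)) - (LBINT x:D. ln (d 0 x))"
    "(LBINT x:DC. ln (d 1 x / d 0 x)) = (LBINT x:DC. ln (d 1 x)) - (LBINT x:DC. ln (d 0 x))"
    using qD(2) qDC(2) dD(2) dDC(2) by (simp_all only:)
  \<comment> \<open>With all integrals split over \<open>D\<close> and \<open>DC\<close>, the
    quotient term replaces \<open>d 1\<close> by \<open>d 0\<close> on \<open>DC\<close> in the
    formula for k = 1, and \<open>d 0\<close> by \<open>d 1\<close> on \<open>D\<close> in that for
    k = 0. Both become the integral of the minimum.\<close>
  show ?thesis
    using int_m intD[of 1] intDC[of 0] qD(1) qDC(1) lower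
    unfolding min_eq quot E[of 0] E[of 1]
    by (simp add: algebra_simps)
qed

end
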